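(* Let $l\ge2$ be an integer and let $L_{rel}$ be a first-order language with relational vocabulary $\{R_1,\ldots,R_\rho\}$, $\rho>0$, where each $R_k$ has arity $r_k\ge2$. For every $I\subseteq\{1,\ldots,\rho\}$ the following hold: (i) There is an $L_{rel}$-formula $\xi(x,y)$ such that for almost all $\mathcal{M}\in\mathbf{C}^I$ the following holds: for every $l$-colouring $\gamma:M\to\{1,\ldots,l\}$ of $\mathcal{M}$ and all $a,b\in M$, $\gamma(a)=\gamma(b)$ if and only if $\mathcal{M}\models\xi(a,b)$. (ii) Almost all $\mathcal{M}\in\mathbf{C}^I$ are uniquely $l$-colourable. (iii) $\mathbf{C}^I$ has a zero-one law.
   Context: An $l$-colouring of an $L_{rel}$-structure $\mathcal{M}$ is a function $\gamma:M\to\{1,\ldots,l\}$ such that for every $k$ and every $(a_1,\ldots,a_{r_k})\in R_k^{\mathcal{M}}$ there are $i,j$ with $\gamma(a_i)\ne\gamma(a_j)$. $\mathcal{M}$ is $l$-colourable if it has an $l$-colouring, and uniquely $l$-colourable if it is $l$-colourable and for all $l$-colourings $\gamma,\gamma'$ of $\mathcal{M}$ and all $a,b\in M$, $\gamma(a)=\gamma(b)\Leftrightarrow\gamma'(a)=\gamma'(b)$. For $I\subseteq\{1,\ldots,\rho\}$, $\mathbf{C}^I_n$ is the set of $l$-colourable $L_{rel}$-structures $\mathcal{M}$ with universe $\{1,\ldots,n\}$ such that for every $k\in I$, $R_k^{\mathcal{M}}$ is irreflexive (all entries of each tuple in it are distinct) and symmetric (closed under permuting the entries of tuples). $\mathbf{C}^I=\bigcup_{n\geq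 1}\mathbf{C}^I_n$. "Almost all $\mathcal{M}\in\mathbf{C}^I$ have property $P$" means that the proportion of $\mathcal{M}\in\mathbf{C}^I_n$ with property $P$ approaches $1$ as $n\to\infty$. "$\mathbf{C}^I$ has a zero-one law" means that for every $L_{rel}$-sentence $\varphi$, either $\varphi$ or $\neg\varphi$ is satisfied by almost all $\mathcal{M}\in\mathbf{C}^I$. *)

theory Defs
  imports Complex_Main "HOL-Library.FuncSet" "HOL-Library.Multiset"
begin

text \<open>
  A finite relational vocabulary \<open>{R\<^sub>1, ..., R\<^sub>\<rho>}\<close> is given by the number \<open>\<rho>\<close> of symbols and
  the arity function \<open>r\<close>; the symbols are the indices \<open>k \<in> {1..\<rho>}\<close>, and a tuple is a list.
\<close>

record 'a rel_struct =
  universe :: "'a set"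
  rel :: "nat \<Rightarrow> 'a list set"

text \<open>
  Requiring \<open>rel M k = {}\<close> for indices outside the vocabulary makes every structure have
  exactly one representation, so that structures can be counted.
\<close>

definition is_struct :: "nat \<Rightarrow> (nat \<Rightarrow> nat) \<Rightarrow> 'a rel_struct \<Rightarrow> bool" where
  "is_struct \<rho> r M \<longleftrightarrow>
     universe M \<noteq> {} \<and>
     (\<forall>k\<in>{1..\<rho>}. rel M k \<subseteq> {as. set as \<subseteq> universe M \<and> length as = r k}) \<and>
     (\<forall>k. k \<notin> {1..\<rho>} \<longrightarrow> rel M k = {})"

text \<open>
  First-order formulas with equality; variables are natural numbers, and the remaining
  connectives and the universal quantifier are definable from the ones below.
\<close>

datatype fm =
    Eq nat nat
  | Rel nat "nat list"
  | Neg fm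
  | Conj fm fm
  | Ex nat fm

primrec is_fm :: "nat \<Rightarrow> (nat \<Rightarrow> nat) \<Rightarrow> fm \<Rightarrow> bool" where
  "is_fm \<rho> r (Eq x y) \<longleftrightarrow> True"
| "is_fm \<rho> r (Rel k xs) \<longleftrightarrow> k \<in> {1..\<rho>} \<and> length xs = r k"
| "is_fm \<rho> r (Neg \<phi>) \<longleftrightarrow> is_fm \<rho> r \<phi>"
| "is_fm \<rho> r (Conj \<phi> \<psi>) \<longleftrightarrow> is_fm \<rho> r \<phi> \<and> is_fm \<rho> r \<psi>"
| "is_fm \<rho> r (Ex x \<phi>) \<longleftrightarrow> is_fm \<rho> r \<phi>"

primrec fv :: "fm \<Rightarrow> nat set" where
  "fv (Eq x y) = {x, y}"
| "fv (Rel k xs) = set xs"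
| "fv (Neg \<phi>) = fv \<phi>"
| "fv (Conj \<phi> \<psi>) = fv \<phi> \<union> fv \<psi>"
| "fv (Ex x \<phi>) = fv \<phi> - {x}"

primrec sat :: "'a rel_struct \<Rightarrow> (nat \<Rightarrow> 'a) \<Rightarrow> fm \<Rightarrow> bool" where
  "sat M e (Eq x y) \<longleftrightarrow> e x = e y"
| "sat M e (Rel k xs) \<longleftrightarrow> map e xs \<in> rel M k"
| "sat M e (Neg \<phi>) \<longleftrightarrow> \<not> sat M e \<phi>"
| "sat M e (Conj \<phi> \<psi>) \<longleftrightarrow> sat M e \<phi> \<and> sat M e \<psi>"
| "sat M e (Ex x \<phi>) \<longleftrightarrow> (\<exists>a\<in>universe M. sat M (e(x := a)) \<phi>)"

definition sentence :: "nat \<Rightarrow> (nat \<Rightarrow> nat) \<Rightarrow> fm \<Rightarrow> bool" where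
  "sentence \<rho> r \<phi> \<longleftrightarrow> is_fm \<rho> r \<phi> \<and> fv \<phi> = {}"

definition models :: "'a rel_struct \<Rightarrow> fm \<Rightarrow> bool" where
  "models M \<phi> \<longleftrightarrow> (\<forall>e\<in>UNIV \<rightarrow> universe M. sat M e \<phi>)"

text \<open>
  In a formula \<open>\<xi>(x,y)\<close>, the variable \<open>x\<close> is \<open>0\<close> and \<open>y\<close> is \<open>1\<close>; the values given to all other
  variables are irrelevant since these do not occur free.
\<close>

definition binary_fm :: "nat \<Rightarrow> (nat \<Rightarrow> nat) \<Rightarrow> fm \<Rightarrow> bool" where
  "binary_fm \<rho> r \<xi> \<longleftrightarrow> is_fm \<rho> r \<xi> \<and> fv \<xi> \<subseteq> {0, 1}"

definition models2 :: "'a rel_struct \<Rightarrow> fm \<Rightarrow> 'a \<Rightarrow> 'a \<Rightarrow> bool" where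
  "models2 M \<xi> a b \<longleftrightarrow> sat M (\<lambda>v. if v = 0 then a else b) \<xi>"

definition colouring :: "nat \<Rightarrow> nat \<Rightarrow> 'a rel_struct \<Rightarrow> ('a \<Rightarrow> nat) \<Rightarrow> bool" where
  "colouring \<rho> l M \<gamma> \<longleftrightarrow>
     \<gamma> \<in> universe M \<rightarrow> {1..l} \<and>
     (\<forall>k\<in>{1..\<rho>}. \<forall>as\<in>rel M k. \<exists>i<length as. \<exists>j<length as. \<gamma> (as ! i) \<noteq> \<gamma> (as ! j))"

definition colourable :: "nat \<Rightarrow> nat \<Rightarrow> 'a rel_struct \<Rightarrow> bool" where
  "colourable \<rho> l M \<longleftrightarrow> (\<exists>\<gamma>. colouring \<rho> l M \<gamma>)"

definition uniquely_colourable :: "nat \<Rightarrow> nat \<Rightarrow> 'a rel_struct \<Rightarrow> bool" where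
  "uniquely_colourable \<rho> l M \<longleftrightarrow>
     colourable \<rho> l M \<and>
     (\<forall>\<gamma> \<gamma>'. colouring \<rho> l M \<gamma> \<longrightarrow> colouring \<rho> l M \<gamma>' \<longrightarrow>
        (\<forall>a\<in>universe M. \<forall>b\<in>universe M. \<gamma> a = \<gamma> b \<longleftrightarrow> \<gamma>' a = \<gamma>' b))"

definition irreflexive_rel :: "'a list set \<Rightarrow> bool" where
  "irreflexive_rel R \<longleftrightarrow> (\<forall>as\<in>R. distinct as)"

definition symmetric_rel :: "'a list set \<Rightarrow> bool" where
  "symmetric_rel R \<longleftrightarrow> (\<forall>as\<in>R. \<forall>bs. mset bs = mset as \<longrightarrow> bs \<in> R)"

definition C :: "nat \<Rightarrow> (nat \<Rightarrow> nat) \<Rightarrow> nat \<Rightarrow> nat set \<Rightarrow> nat \<Rightarrow> nat rel_struct set" where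
  "C \<rho> r l I n =
     {M. is_struct \<rho> r M \<and> universe M = {1..n} \<and> colourable \<rho> l M \<and>
         (\<forall>k\<in>I. irreflexive_rel (rel M k) \<and> symmetric_rel (rel M k))}"

text \<open>
  For a sequence \<open>K\<close> of finite sets of structures; the sets \<open>C \<rho> r l I n\<close> are finite, and
  nonempty for \<open>n \<ge> 1\<close> and \<open>l \<ge> 1\<close>.
\<close>

definition almost_all :: "(nat \<Rightarrow> 'a set) \<Rightarrow> ('a \<Rightarrow> bool) \<Rightarrow> bool" where
  "almost_all K P \<longleftrightarrow>
     (\<lambda>n. real (card {M \<in> K n. P M}) / real (card (K n))) \<longlonglongrightarrow> 1"

definition zero_one_law ::
    "nat \<Rightarrow> (nat \<Rightarrow> nat) \<Rightarrow> (nat \<Rightarrow> 'a rel_struct set) \<Rightarrow> bool" where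
  "zero_one_law \<rho> r K \<longleftrightarrow>
     (\<forall>\<phi>. sentence \<rho> r \<phi> \<longrightarrow>
        almost_all K (\<lambda>M. models M \<phi>) \<or> almost_all K (\<lambda>M. models M (Neg \<phi>)))"

end

theory Submission
  imports Defs "HOL-Library.Disjoint_Sets" "HOL-Real_Asymp.Real_Asymp"
begin

text \<open>
  Count pairs of a structure and one of its colourings. For a fixed colouring, the structures it
  colours correspond to the subsets of the set of non-monochromatic atoms. Moving a linear number
  of elements from the largest colour class to a class of size less than \<open>n div (8 * l)\<close> creates
  quadratically many new atoms, so all such colourings together contribute a vanishing share of
  the pairs. For the remaining colourings, independence makes every extension axiom (over the
  structure expanded by its colours) fail with exponentially small probability. The extension
  axioms force the colouring to be unique up to renaming colours, so each structure occurs in a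
  bounded number of good pairs and the bound passes from pairs to structures. They also make the
  colour classes definable by a gadget, and any two structures satisfying them agree on sentences
  of bounded width by a back-and-forth argument that preserves colours.
\<close>

text \<open>Colourability is a global condition, so a uniformly chosen structure has no visible
  independence; once the colouring is fixed, each non-monochromatic atom becomes a fair coin. The
  price is that a structure is counted once for each of its colourings. This can be paid back only
  after uniqueness is known, hence concentration is shown for pairs and transferred later. Balance
  matters because an extension axiom asks for a witness of a given colour: a linear number of
  candidates is what defeats polynomially many axioms. There are at most \<open>l ^ n\<close>
  unbalanced colourings, which a quadratic gain in the exponent absorbs; the factor 8 keeps the
  fullest class far larger than the deficient one even after the transfer. The extension axioms
  mention a colouring and are not sentences of the language. The zero-one law does not rewrite them
  by the defining formula: it suffices that two structures each carry some colouring with the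
  extension property, and the back-and-forth argument runs between those two colourings.\<close>

definition monochromatic :: "('a \<Rightarrow> nat) \<Rightarrow> 'a set \<Rightarrow> bool" where
  "monochromatic \<gamma> S \<longleftrightarrow> (\<exists>c. \<forall>x\<in>S. \<gamma> x = c)"

lemma monochromatic_image: "monochromatic \<gamma> (f ` S) \<longleftrightarrow> monochromatic (\<gamma> \<circ> f) S"
  by (auto simp: monochromatic_def)

lemma monochromatic_cong:
  "(\<And>x. x \<in> S \<Longrightarrow> \<gamma> x = \<gamma>' x) \<Longrightarrow> monochromatic \<gamma> S \<longleftrightarrow> monochromatic \<gamma>' S"
  by (auto simp: monochromatic_def)

lemma not_monochromatic_set_iff:
  "\<not> monochromatic \<gamma> (set as) \<longleftrightarrow>
     (\<exists>i<length as. \<exists>j<length as. \<gamma> (as ! i) \<noteq> \<gamma> (as ! j))"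
proof
  assume "\<not> monochromatic \<gamma> (set as)"
  then obtain x where "x \<in> set as" "\<gamma> x \<noteq> \<gamma> (as ! 0)"
    unfolding monochromatic_def by blast
  then show "\<exists>i<length as. \<exists>j<length as. \<gamma> (as ! i) \<noteq> \<gamma> (as ! j)"
    by (metis in_set_conv_nth length_pos_if_in_set)
qed (metis monochromatic_def nth_mem)

text \<open>Extension axioms are stated for lists of exactly \<open>m\<close> entries, which makes
  them easy to count; repeating \<open>z\<close> lets them apply to every set of at most
  \<open>m\<close> points.\<close>

lemma exists_padded_list:
  assumes "finite X" "card X \<le> m"
  shows "\<exists>xs. length xs = m \<and> X \<subseteq> set xs \<and> set xs \<subseteq> insert z X"
proof -
  obtain ys where "set ys = X" "distinct ys"
    using finite_distinct_list[OF assms(1)] by blast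
  moreover from this have "length ys \<le> m" using assms distinct_card by metis
  ultimately show ?thesis
    by (intro exI[of _ "ys @ replicate (m - length ys) z"]) auto
qed

section \<open>Counting subsets that avoid prescribed patterns\<close>

text \<open>For a uniformly random \<open>T \<subseteq> U\<close> the traces on disjoint blocks are
  independent, and the trace on \<open>B b\<close> equals the target \<open>P b\<close> with
  probability at least \<open>1 / 2 ^ c\<close>. So each block is missed with probability at most
  \<open>1 - 1 / 2 ^ c\<close>.\<close>

lemma card_avoiding_subsets_le:
  fixes B P :: "'b \<Rightarrow> 'a set"
  assumes "finite J" "finite U"
    and "\<And>b. b \<in> J \<Longrightarrow> B b \<subseteq> U" "\<And>b. b \<in> J \<Longrightarrow> P b \<subseteq> B b"
    and "\<And>b. b \<in> J \<Longrightarrow> card (B b) \<le> c"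
    and "disjoint_family_on B J"
  shows "real (card {T \<in> Pow U. \<forall>b\<in>J. T \<inter> B b \<noteq> P b}) \<le> 2 ^ card U * (1 - 1 / 2 ^ c) ^ card J"
  using assms
proof (induction J arbitrary: U rule: finite_induct)
  case empty
  then show ?case by (simp add: card_Pow flip: Pow_def)
next
  case (insert b J)
  let ?S = "{T \<in> Pow U. \<forall>b\<in>insert b J. T \<inter> B b \<noteq> P b}"
  let ?S' = "{T \<in> Pow (U - B b). \<forall>b\<in>J. T \<inter> B b \<noteq> P b}"
  have BU: "B b \<subseteq> U" and Pb: "P b \<subseteq> B b" and fB: "finite (B b)"
    using insert.prems finite_subset[of "B b" U] by auto
  have disj: "B b' \<inter> B b = {}" if "b' \<in> J" for b'
    using insert.prems(5) insert.hyps(2) that by (auto simp: disjoint_family_on_def)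
  have IH: "real (card ?S') \<le> 2 ^ card (U - B b) * (1 - 1 / 2 ^ c) ^ card J"
  proof (rule insert.IH)
    show "B b' \<subseteq> U - B b" if "b' \<in> J" for b'
      using disj[OF that] insert.prems(2)[of b'] that by blast
    show "disjoint_family_on B J"
      using insert.prems(5) by (auto simp: disjoint_family_on_def)
  qed (use insert.prems in auto)
  have "inj_on (\<lambda>T. (T \<inter> B b, T - B b)) ?S"
    by (rule inj_onI) (metis Int_Diff_Un Pair_inject)
  moreover have "(\<lambda>T. (T \<inter> B b, T - B b)) ` ?S \<subseteq> (Pow (B b) - {P b}) \<times> ?S'"
  proof -
    have "(T - B b) \<inter> B b' = T \<inter> B b'" if "b' \<in> J" for T b'
      using disj[OF that] by blast
    then show ?thesis by auto
  qed
  moreover have "finite ((Pow (B b) - {P b}) \<times> ?S')"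
    using insert.prems fB by auto
  ultimately have "card ?S \<le> card ((Pow (B b) - {P b}) \<times> ?S')"
    by (rule card_inj_on_le)
  also have "\<dots> = (2 ^ card (B b) - 1) * card ?S'"
    using fB Pb by (simp add: card_cartesian_product card_Pow)
  finally have "real (card ?S) \<le> real (2 ^ card (B b) - 1) * real (card ?S')"
    unfolding of_nat_mult[symmetric] of_nat_le_iff .
  also have "real (2 ^ card (B b) - 1) = 2 ^ card (B b) * (1 - 1 / 2 ^ card (B b))"
    by (simp add: of_nat_diff field_simps)
  also have "\<dots> \<le> 2 ^ card (B b) * (1 - 1 / 2 ^ c)"
    using insert.prems(4)[of b] by (simp add: frac_le)
  also have "2 ^ card (B b) * (1 - 1 / 2 ^ c) * real (card ?S')
      \<le> 2 ^ card (B b) * (1 - 1 / 2 ^ c) * (2 ^ card (U - B b) * (1 - 1 / 2 ^ c) ^ card J)"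
    using IH by (intro mult_left_mono) auto
  also have "\<dots> = 2 ^ (card (B b) + card (U - B b)) * (1 - 1 / 2 ^ c) ^ card (insert b J)"
    using insert.hyps by (simp add: power_add)
  also have "card (B b) + card (U - B b) = card U"
    using BU fB insert.prems(1) by (simp add: card_Diff_subset card_mono)
  finally show ?case by (simp add: mult_right_mono)
qed

section \<open>Convexity of the number of monochromatic tuples\<close>

text \<open>The increments of a convex \<open>f\<close> grow, by at least one per step from
  \<open>R\<close> on; of the \<open>d\<close> steps starting at \<open>x\<close> at least
  \<open>d - R\<close> lie in that range. The additive form avoids truncated subtraction of values
  of \<open>f\<close>.\<close>

lemma increment_growth:
  fixes f :: "nat \<Rightarrow> nat"
  assumes "\<And>x. 2 * f (Suc x) \<le> f x + f (Suc (Suc x))"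
    and "\<And>x. R \<le> x \<Longrightarrow> 2 * f (Suc x) + 1 \<le> f x + f (Suc (Suc x))"
  shows "f (Suc x) + f (x + d) + (d - R) \<le> f (Suc (x + d)) + f x"
proof (induction d)
  case (Suc d)
  then show ?case using assms(1)[of "x + d"] assms(2)[of "x + d"]
    by (cases "R \<le> x + d") auto
qed simp

text \<open>Move \<open>h\<close> points one at a time out of a class of size \<open>b + h\<close>
  into one of size \<open>s\<close>: each transfer compares two increments of \<open>f\<close> at
  distance \<open>b - s\<close>, hence gains at least \<open>b - s - R\<close>.\<close>

lemma convex_shift_gain:
  fixes f :: "nat \<Rightarrow> nat"
  assumes "\<And>x. 2 * f (Suc x) \<le> f x + f (Suc (Suc x))"
    and "\<And>x. R \<le> x \<Longrightarrow> 2 * f (Suc x) + 1 \<le> f x + f (Suc (Suc x))"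
    and "s \<le> b"
  shows "f b + f (s + h) + h * (b - s - R) \<le> f (b + h) + f s"
proof (induction h)
  case (Suc h)
  have "f (Suc (s + h)) + f (b + h) + (b - s - R) \<le> f (Suc (b + h)) + f (s + h)"
    using increment_growth[of f R "s + h" "b - s"] assms by (simp add: add.commute add.left_commute)
  with Suc show ?case by (simp add: algebra_simps)
qed simp

lemma power_second_difference:
  fixes x r :: nat
  assumes "2 \<le> r"
  shows "2 * Suc x ^ r + 1 \<le> x ^ r + Suc (Suc x) ^ r"
  using assms
proof (induction r rule: dec_induct)
  case base
  show ?case by (simp add: power2_eq_square)
next
  case (step r)
  have "x ^ r \<le> Suc (Suc x) ^ r" by (intro power_mono) auto
  then have "2 * Suc x ^ Suc r + 1 \<le> Suc x * (2 * Suc x ^ r + 1) + (Suc (Suc x) ^ r - x ^ r)"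
    by simp
  also have "\<dots> \<le> Suc x * (x ^ r + Suc (Suc x) ^ r) + (Suc (Suc x) ^ r - x ^ r)"
    using step.IH by (intro add_right_mono mult_left_mono) auto
  \<comment> \<open>\<open>(x + 1) * x ^ r\<close> exceeds \<open>x ^ Suc r\<close> by
    \<open>x ^ r\<close>, and \<open>(x + 1) * (x + 2) ^ r\<close> falls short of
    \<open>(x + 2) ^ Suc r\<close> by \<open>(x + 2) ^ r\<close>; the added difference cancels
    both.\<close>
  also have "\<dots> = x ^ Suc r + Suc (Suc x) ^ Suc r"
    using \<open>x ^ r \<le> Suc (Suc x) ^ r\<close> by (simp add: algebra_simps)
  finally show ?case .
qed

text \<open>By Pascal's rule. The second difference \<open>x choose r\<close> vanishes for
  \<open>x < r\<close>, which is why strict convexity is only asked for from some \<open>R\<close>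
  on.\<close>

lemma binomial_second_difference:
  "(Suc (Suc x) choose Suc (Suc r)) + (x choose Suc (Suc r)) = 2 * (Suc x choose Suc (Suc r)) + (x choose r)"
  by simp

locale coloured_vocabulary =
  fixes l \<rho> :: nat and r :: "nat \<Rightarrow> nat" and I :: "nat set"
  assumes two_le_l: "l \<ge> 2"
    and rho_pos: "\<rho> > 0"
    and arity: "\<And>k. k \<in> {1..\<rho>} \<Longrightarrow> r k \<ge> 2"
    and I_subset: "I \<subseteq> {1..\<rho>}"
begin

section \<open>Atoms\<close>

text \<open>
  A structure of the class is determined by a set of independent atoms: an atom is a tuple if
  \<open>k \<notin> I\<close>, and an \<open>r k\<close>-element set if \<open>k \<in> I\<close>.
\<close>

definition atom :: "nat \<Rightarrow> 'a list \<Rightarrow> nat \<times> 'a set \<times> 'a list" where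
  "atom k as = (k, if k \<in> I then set as else {}, if k \<in> I then [] else as)"

definition map_atom :: "('a \<Rightarrow> 'b) \<Rightarrow> nat \<times> 'a set \<times> 'a list \<Rightarrow> nat \<times> 'b set \<times> 'b list" where
  "map_atom f = (\<lambda>(k, S, as). (k, f ` S, map f as))"

definition supp :: "nat \<times> 'a set \<times> 'a list \<Rightarrow> 'a set" where
  "supp = (\<lambda>(k, S, as). S \<union> set as)"

definition admissible :: "'a set \<Rightarrow> nat \<Rightarrow> 'a list \<Rightarrow> bool" where
  "admissible A k as \<longleftrightarrow>
     k \<in> {1..\<rho>} \<and> length as = r k \<and> set as \<subseteq> A \<and> (k \<in> I \<longrightarrow> distinct as)"

definition atoms_of :: "'a set \<Rightarrow> nat \<Rightarrow> (nat \<times> 'a set \<times> 'a list) set" where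
  "atoms_of A k = {atom k as | as. admissible A k as}"

definition atoms :: "'a set \<Rightarrow> (nat \<times> 'a set \<times> 'a list) set" where
  "atoms A = (\<Union>k\<in>{1..\<rho>}. atoms_of A k)"

text \<open>The number of atoms of symbol \<open>k\<close> inside a set of \<open>x\<close> points,
  see \<open>card_atoms_of\<close>; a colour class of size \<open>x\<close> forbids exactly
  these.\<close>

definition clique_count :: "nat \<Rightarrow> nat \<Rightarrow> nat" where
  "clique_count k x = (if k \<in> I then x choose r k else x ^ r k)"

lemma map_atom_atom: "map_atom f (atom k as) = atom k (map f as)"
  by (simp add: map_atom_def atom_def)

lemma supp_atom [simp]: "supp (atom k as) = set as"
  by (auto simp: supp_def atom_def)

lemma supp_map_atom: "supp (map_atom f x) = f ` supp x"
  by (cases x) (auto simp: supp_def map_atom_def)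

lemma map_atom_cong: "(\<And>v. v \<in> supp x \<Longrightarrow> f v = g v) \<Longrightarrow> map_atom f x = map_atom g x"
  by (cases x) (auto simp: supp_def map_atom_def)

lemma map_atom_comp: "map_atom f (map_atom g x) = map_atom (f \<circ> g) x"
  by (cases x) (auto simp: map_atom_def)

lemma map_atom_id: "map_atom id x = x"
  by (cases x) (auto simp: map_atom_def)

lemma atoms_of_eq:
  assumes "k \<in> {1..\<rho>}" "finite A"
  shows "atoms_of A k =
    (if k \<in> I then (\<lambda>S. (k, S, [])) ` {S. S \<subseteq> A \<and> card S = r k}
     else (\<lambda>as. (k, {}, as)) ` {as. set as \<subseteq> A \<and> length as = r k})"
proof (cases "k \<in> I")
  case True
  have "\<exists>as. S = set as \<and> length as = r k \<and> set as \<subseteq> A \<and> distinct as"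
    if S: "S \<subseteq> A" "card S = r k" for S
  proof -
    obtain as where "set as = S" "distinct as"
      using finite_distinct_list[of S] S(1) assms(2) finite_subset by blast
    then show ?thesis using S distinct_card[of as] by auto
  qed
  then show ?thesis using True assms
    by (auto simp: atoms_of_def admissible_def atom_def distinct_card image_iff)
qed (use assms in \<open>auto simp: atoms_of_def admissible_def atom_def image_iff\<close>)

lemma finite_atoms_of: "finite A \<Longrightarrow> k \<in> {1..\<rho>} \<Longrightarrow> finite (atoms_of A k)"
  by (auto simp: atoms_of_eq finite_lists_length_eq)

lemma finite_atoms: "finite A \<Longrightarrow> finite (atoms A)"
  by (auto simp: atoms_def finite_atoms_of)

lemma card_atoms_of:
  assumes "k \<in> {1..\<rho>}" "finite A"
  shows "card (atoms_of (A :: 'a set) k) = clique_count k (card A)"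
proof -
  have "inj_on (\<lambda>S. (k, S, [] :: 'a list)) Y" "inj_on (\<lambda>as. (k, {} :: 'a set, as)) Z"
    for Y :: "'a set set" and Z :: "'a list set"
    by (auto simp: inj_on_def)
  then show ?thesis using assms
    by (simp add: atoms_of_eq card_image n_subsets card_lists_length_eq clique_count_def)
qed

lemma clique_count_le: "clique_count k x \<le> x ^ r k"
  using binomial_le_pow[of "r k" x] by (cases "r k \<le> x") (auto simp: clique_count_def binomial_eq_0)

lemma card_atoms_le:
  assumes "finite A" "card A \<le> m"
  shows "card (atoms A) \<le> (\<Sum>k=1..\<rho>. m ^ r k)"
proof -
  have "card (atoms A) \<le> (\<Sum>k\<in>{1..\<rho>}. card (atoms_of A k))"
    unfolding atoms_def by (rule card_UN_le) auto
  also have "\<dots> \<le> (\<Sum>k=1..\<rho>. m ^ r k)"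
    using assms clique_count_le power_mono[OF assms(2)]
    by (intro sum_mono) (metis card_atoms_of le0 order_trans)
  finally show ?thesis .
qed

lemma fst_atoms_of: "x \<in> atoms_of A k \<Longrightarrow> fst x = k"
  by (auto simp: atoms_of_def atom_def)

lemma supp_atoms_of: "x \<in> atoms_of A k \<Longrightarrow> supp x \<subseteq> A"
  by (auto simp: atoms_of_def admissible_def)

lemma supp_atoms_of_nonempty: "x \<in> atoms_of A k \<Longrightarrow> supp x \<noteq> {}"
  using arity by (fastforce simp: atoms_of_def admissible_def)

lemma atom_in_atoms: "admissible A k as \<Longrightarrow> atom k as \<in> atoms A"
  by (auto simp: atoms_def atoms_of_def admissible_def)

lemma atomsE:
  assumes "x \<in> atoms A"
  obtains k as where "x = atom k as" "admissible A k as"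
  using assms by (auto simp: atoms_def atoms_of_def)

lemma clique_count_convex:
  assumes "k \<in> {1..\<rho>}"
  shows "2 * clique_count k (Suc x) \<le> clique_count k x + clique_count k (Suc (Suc x))"
    and "r k \<le> x \<Longrightarrow> 2 * clique_count k (Suc x) + 1 \<le> clique_count k x + clique_count k (Suc (Suc x))"
proof -
  obtain t where t: "r k = Suc (Suc t)"
    using arity[OF assms] by (metis add_2_eq_Suc le_Suc_ex)
  have "x choose t \<ge> 1" if "r k \<le> x"
    using that t by (simp add: Suc_le_eq)
  then show "2 * clique_count k (Suc x) \<le> clique_count k x + clique_count k (Suc (Suc x))"
    and "r k \<le> x \<Longrightarrow> 2 * clique_count k (Suc x) + 1 \<le> clique_count k x + clique_count k (Suc (Suc x))"
    using power_second_difference[of "r k" x] arity[OF assms] binomial_second_difference[of x t]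
    by (auto simp: clique_count_def t)
qed

section \<open>Structures as sets of atoms\<close>

definition in_class :: "nat \<Rightarrow> nat rel_struct \<Rightarrow> bool" where
  "in_class n M \<longleftrightarrow> is_struct \<rho> r M \<and> universe M = {1..n} \<and>
     (\<forall>k\<in>I. irreflexive_rel (rel M k) \<and> symmetric_rel (rel M k))"

definition diagram :: "'a rel_struct \<Rightarrow> (nat \<times> 'a set \<times> 'a list) set" where
  "diagram M = {atom k as | k as. as \<in> rel M k}"

text \<open>Extensional functions: colourings that differ only off the universe are identified, so
  that there are exactly \<open>l ^ n\<close> candidates.\<close>

definition colourings :: "nat \<Rightarrow> (nat \<Rightarrow> nat) set" where
  "colourings n = {1..n} \<rightarrow>\<^sub>E {1..l}"

definition coloured_by :: "nat \<Rightarrow> (nat \<Rightarrow> nat) \<Rightarrow> nat rel_struct set" where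
  "coloured_by n \<gamma> = {M. in_class n M \<and> colouring \<rho> l M \<gamma>}"

definition free_atoms :: "nat \<Rightarrow> (nat \<Rightarrow> nat) \<Rightarrow> (nat \<times> nat set \<times> nat list) set" where
  "free_atoms n \<gamma> = {x \<in> atoms {1..n}. \<not> monochromatic \<gamma> (supp x)}"

lemma rel_admissible:
  assumes "in_class n M" "as \<in> rel M k"
  shows "admissible {1..n} k as"
proof -
  have "k \<in> {1..\<rho>}" using assms by (auto simp: in_class_def is_struct_def)
  with assms show ?thesis
    unfolding in_class_def is_struct_def admissible_def irreflexive_rel_def by blast
qed

text \<open>For \<open>k \<in> I\<close> an atom remembers only the set of entries. Two tuples
  without repetitions and with the same atom are permutations of each other, and symmetry of the
  relation does the rest; admissibility is what excludes repetitions.\<close>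

lemma rel_iff_diagram:
  assumes "in_class n M"
  shows "as \<in> rel M k \<longleftrightarrow> admissible {1..n} k as \<and> atom k as \<in> diagram M"
proof
  assume "admissible {1..n} k as \<and> atom k as \<in> diagram M"
  then obtain bs where ad: "admissible {1..n} k as" and bs: "bs \<in> rel M k" "atom k as = atom k bs"
    by (auto simp: diagram_def atom_def)
  show "as \<in> rel M k"
  proof (cases "k \<in> I")
    case True
    have "distinct as" "distinct bs"
      using True ad rel_admissible[OF assms bs(1)] by (auto simp: admissible_def)
    then have "mset as = mset bs"
      using bs(2) True by (auto simp: atom_def set_eq_iff_mset_eq_distinct)
    then show ?thesis using True bs(1) assms
      unfolding in_class_def symmetric_rel_def by blast
  qed (use bs in \<open>auto simp: atom_def\<close>)
qed (use rel_admissible[OF assms] in \<open>auto simp: diagram_def\<close>)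

lemma colouring_iff:
  "colouring \<rho> l M \<gamma> \<longleftrightarrow> \<gamma> \<in> universe M \<rightarrow> {1..l} \<and>
     (\<forall>k\<in>{1..\<rho>}. \<forall>as\<in>rel M k. \<not> monochromatic \<gamma> (set as))"
  by (simp add: colouring_def not_monochromatic_set_iff)

lemma colouring_not_monochromatic:
  assumes "in_class n M" "colouring \<rho> l M \<gamma>" "as \<in> rel M k"
  shows "\<not> monochromatic \<gamma> (set as)"
  using assms rel_admissible[OF assms(1,3)] by (auto simp: colouring_iff admissible_def)

lemma finite_free_atoms: "finite (free_atoms n \<gamma>)"
  by (simp add: free_atoms_def finite_atoms)

lemma bij_betw_diagram:
  assumes "n \<ge> 1" "\<gamma> \<in> colourings n"
  shows "bij_betw diagram (coloured_by n \<gamma>) (Pow (free_atoms n \<gamma>))"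
  unfolding bij_betw_def
proof
  show "inj_on diagram (coloured_by n \<gamma>)"
  proof (rule inj_onI)
    fix M M' assume M: "M \<in> coloured_by n \<gamma>" "M' \<in> coloured_by n \<gamma>" and eq: "diagram M = diagram M'"
    have "as \<in> rel M k \<longleftrightarrow> as \<in> rel M' k" for k as
      using M eq rel_iff_diagram by (auto simp: coloured_by_def)
    then have "rel M = rel M'" by blast
    moreover have "universe M = universe M'" using M by (auto simp: coloured_by_def in_class_def)
    ultimately show "M = M'" by simp
  qed
  show "diagram ` coloured_by n \<gamma> = Pow (free_atoms n \<gamma>)"
  proof
    show "diagram ` coloured_by n \<gamma> \<subseteq> Pow (free_atoms n \<gamma>)"
      using rel_admissible colouring_not_monochromatic
      by (fastforce simp: coloured_by_def diagram_def free_atoms_def intro: atom_in_atoms)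
    show "Pow (free_atoms n \<gamma>) \<subseteq> diagram ` coloured_by n \<gamma>"
    proof
      fix T assume "T \<in> Pow (free_atoms n \<gamma>)"
      then have T: "T \<subseteq> free_atoms n \<gamma>" by simp
      define M where "M = \<lparr>universe = {1..n}, rel = \<lambda>k. {as. admissible {1..n} k as \<and> atom k as \<in> T}\<rparr>"
      have "is_struct \<rho> r M" using assms(1)
        by (auto simp: M_def is_struct_def admissible_def)
      moreover have "irreflexive_rel (rel M k) \<and> symmetric_rel (rel M k)" if "k \<in> I" for k
      proof -
        \<comment> \<open>A permutation of a tuple has the same atom, so any set of atoms yields a
          symmetric relation.\<close>
        have perm: "admissible {1..n} k bs \<and> atom k bs = atom k as"
          if "mset bs = mset as" "admissible {1..n} k as" for as bs :: "nat list"
          using that \<open>k \<in> I\<close> mset_eq_setD[OF that(1)] mset_eq_imp_distinct_iff[OF that(1)]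
            mset_eq_length[OF that(1)]
          by (auto simp: admissible_def atom_def)
        have "symmetric_rel (rel M k)"
          unfolding symmetric_rel_def
        proof (intro ballI allI impI)
          fix as bs assume "as \<in> rel M k" "mset bs = mset as"
          then show "bs \<in> rel M k" using perm[of bs as] by (simp add: M_def)
        qed
        moreover have "irreflexive_rel (rel M k)"
          using \<open>k \<in> I\<close> by (simp add: M_def irreflexive_rel_def admissible_def)
        ultimately show ?thesis by simp
      qed
      moreover have "colouring \<rho> l M \<gamma>"
        using assms(2) T by (auto simp: M_def colouring_iff colourings_def free_atoms_def)
      ultimately have "M \<in> coloured_by n \<gamma>"
        by (auto simp: coloured_by_def in_class_def M_def)
      moreover have "diagram M = T"
      proof
        show "T \<subseteq> diagram M"
        proof
          fix x assume "x \<in> T"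
          with T have "x \<in> atoms {1..n}" by (auto simp: free_atoms_def)
          then obtain k as where "x = atom k as" "admissible {1..n} k as" by (rule atomsE)
          with \<open>x \<in> T\<close> show "x \<in> diagram M" by (auto simp: M_def diagram_def)
        qed
      qed (auto simp: M_def diagram_def)
      ultimately show "T \<in> diagram ` coloured_by n \<gamma>" by blast
    qed
  qed
qed

lemma card_coloured_by:
  assumes "n \<ge> 1" "\<gamma> \<in> colourings n"
  shows "card (coloured_by n \<gamma>) = 2 ^ card (free_atoms n \<gamma>)"
  using bij_betw_same_card[OF bij_betw_diagram[OF assms]] finite_free_atoms by (simp add: card_Pow)

lemma finite_coloured_by:
  assumes "n \<ge> 1" "\<gamma> \<in> colourings n"
  shows "finite (coloured_by n \<gamma>)"
  using bij_betw_finite[OF bij_betw_diagram[OF assms]] finite_free_atoms by simp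

lemma finite_colourings: "finite (colourings n)"
  by (auto simp: colourings_def intro: finite_PiE)

lemma card_colourings: "card (colourings n) = l ^ n"
  by (simp add: colourings_def card_funcsetE)

text \<open>Tuples stay inside the universe, so any colouring may be restricted to it. The union is
  not disjoint: a structure recurs for each of its colourings.\<close>

lemma C_eq: "C \<rho> r l I n = (\<Union>\<gamma>\<in>colourings n. coloured_by n \<gamma>)"
proof -
  have "\<exists>\<gamma>\<in>colourings n. colouring \<rho> l M \<gamma>" if M: "in_class n M" and "colouring \<rho> l M \<gamma>" for M \<gamma>
  proof
    have "monochromatic (restrict \<gamma> {1..n}) (set as) \<longleftrightarrow> monochromatic \<gamma> (set as)"
      if "as \<in> rel M k" for k as
      using rel_admissible[OF M that] by (intro monochromatic_cong) (auto simp: admissible_def)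
    then show "colouring \<rho> l M (restrict \<gamma> {1..n})"
      using that by (auto simp: colouring_iff in_class_def)
    show "restrict \<gamma> {1..n} \<in> colourings n"
      using that by (auto simp: colouring_iff in_class_def colourings_def)
  qed
  then show ?thesis
    by (auto simp: C_def coloured_by_def colourable_def in_class_def)
qed

lemma finite_C:
  assumes "n \<ge> 1"
  shows "finite (C \<rho> r l I n)"
  using assms by (simp add: C_eq finite_colourings finite_coloured_by)

section \<open>Unbalanced colourings admit few structures\<close>

definition colour_class :: "nat \<Rightarrow> (nat \<Rightarrow> nat) \<Rightarrow> nat \<Rightarrow> nat set" where
  "colour_class n \<gamma> c = {x \<in> {1..n}. \<gamma> x = c}"

text \<open>By \<open>card_coloured_by\<close> this is, for \<open>n \<ge> 1\<close>, the number of
  pairs of a structure and one of its colourings.\<close>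

definition coloured_count :: "nat \<Rightarrow> nat" where
  "coloured_count n = (\<Sum>\<gamma>\<in>colourings n. 2 ^ card (free_atoms n \<gamma>))"

lemma finite_colour_class [simp]: "finite (colour_class n \<gamma> c)"
  by (simp add: colour_class_def)

text \<open>A monochromatic atom lies in exactly one colour class, its support being nonempty. In
  this additive form a loss of monochromatic atoms reads directly as a gain of free ones.\<close>

lemma card_free_atoms:
  assumes "\<gamma> \<in> colourings n"
  shows "card (free_atoms n \<gamma>) +
      (\<Sum>k\<in>{1..\<rho>}. \<Sum>c\<in>{1..l}. clique_count k (card (colour_class n \<gamma> c))) = card (atoms {1..n})"
proof -
  let ?mono = "{x \<in> atoms {1..n}. monochromatic \<gamma> (supp x)}"
  let ?A = "\<lambda>p. atoms_of (colour_class n \<gamma> (snd p)) (fst p)"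
  have "?mono = (\<Union>p\<in>{1..\<rho>} \<times> {1..l}. ?A p)"
  proof
    show "?mono \<subseteq> (\<Union>p\<in>{1..\<rho>} \<times> {1..l}. ?A p)"
    proof
      fix x assume "x \<in> ?mono"
      then obtain k as where x: "x = atom k as" "admissible {1..n} k as"
        by (auto elim: atomsE)
      with \<open>x \<in> ?mono\<close> obtain c where c: "\<forall>v\<in>set as. \<gamma> v = c"
        by (auto simp: monochromatic_def)
      \<comment> \<open>The empty set would be monochromatic for every \<open>c\<close>, in range or
        not.\<close>
      from x have "as \<noteq> []" using arity by (fastforce simp: admissible_def)
      then obtain v where "v \<in> set as" by (cases as) auto
      with x(2) c have "v \<in> {1..n}" "\<gamma> v = c" by (auto simp: admissible_def)
      with assms have "c \<in> {1..l}" unfolding colourings_def by blast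
      moreover have "x \<in> atoms_of (colour_class n \<gamma> c) k"
        unfolding x(1) atoms_of_def using x(2) c
        by (fastforce simp: admissible_def colour_class_def intro!: exI[of _ as])
      ultimately show "x \<in> (\<Union>p\<in>{1..\<rho>} \<times> {1..l}. ?A p)"
        using x(2) by (intro UN_I[of "(k, c)"]) (auto simp: admissible_def)
    qed
    show "(\<Union>p\<in>{1..\<rho>} \<times> {1..l}. ?A p) \<subseteq> ?mono"
      by (fastforce simp: atoms_def atoms_of_def admissible_def colour_class_def monochromatic_def)
  qed
  moreover have "card (\<Union>p\<in>{1..\<rho>} \<times> {1..l}. ?A p) = (\<Sum>p\<in>{1..\<rho>} \<times> {1..l}. card (?A p))"
  proof (rule card_UN_disjoint)
    show "\<forall>p\<in>{1..\<rho>} \<times> {1..l}. finite (?A p)" by (auto intro: finite_atoms_of)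
    show "\<forall>p\<in>{1..\<rho>} \<times> {1..l}. \<forall>q\<in>{1..\<rho>} \<times> {1..l}. p \<noteq> q \<longrightarrow> ?A p \<inter> ?A q = {}"
    proof (intro ballI impI)
      fix p q :: "nat \<times> nat" assume "p \<noteq> q"
      have "p = q" if x: "x \<in> ?A p" "x \<in> ?A q" for x :: "nat \<times> nat set \<times> nat list"
      proof -
        obtain v where "v \<in> supp x" using supp_atoms_of_nonempty[OF x(1)] by blast
        then have "v \<in> colour_class n \<gamma> (snd p)" "v \<in> colour_class n \<gamma> (snd q)"
          using x[THEN supp_atoms_of] by auto
        then show ?thesis
          using x[THEN fst_atoms_of] by (auto simp: colour_class_def prod_eq_iff)
      qed
      with \<open>p \<noteq> q\<close> show "?A p \<inter> ?A q = {}" by blast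
    qed
  qed simp
  moreover have "(\<Sum>p\<in>{1..\<rho>} \<times> {1..l}. card (?A p)) =
      (\<Sum>k\<in>{1..\<rho>}. \<Sum>c\<in>{1..l}. clique_count k (card (colour_class n \<gamma> c)))"
    unfolding sum.cartesian_product
    by (intro sum.cong) (auto simp: card_atoms_of)
  moreover have "card (atoms {1..n}) = card (free_atoms n \<gamma>) + card ?mono"
  proof -
    have "atoms {1..n} = free_atoms n \<gamma> \<union> ?mono" "free_atoms n \<gamma> \<inter> ?mono = {}"
      by (auto simp: free_atoms_def)
    then show ?thesis using finite_atoms[of "{1..n}"]
      by (metis (no_types, lifting) card_Un_disjoint finite_Un finite_atLeastAtMost)
  qed
  ultimately show ?thesis by simp
qed

lemma sum_card_colour_class:
  assumes "\<gamma> \<in> colourings n"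
  shows "(\<Sum>c\<in>{1..l}. card (colour_class n \<gamma> c)) = n"
proof -
  have "{1..n} = (\<Union>c\<in>{1..l}. colour_class n \<gamma> c)"
    using assms by (auto simp: colour_class_def colourings_def)
  moreover have "card (\<Union>c\<in>{1..l}. colour_class n \<gamma> c) = (\<Sum>c\<in>{1..l}. card (colour_class n \<gamma> c))"
    by (rule card_UN_disjoint) (auto simp: colour_class_def)
  ultimately show ?thesis by (metis card_atLeastAtMost diff_Suc_1)
qed

text \<open>The monochromatic atoms are counted by convex functions of the class sizes, so levelling
  two very unequal classes lowers their number.\<close>

lemma unbalanced_shift:
  assumes \<gamma>: "\<gamma> \<in> colourings n" and q: "q = n div (8 * l)"
    and R: "\<And>k. k \<in> {1..\<rho>} \<Longrightarrow> r k \<le> q"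
    and i: "i \<in> {1..l}" "card (colour_class n \<gamma> i) < q"
  shows "\<exists>\<gamma>'\<in>colourings n. card (free_atoms n \<gamma>) + q * q \<le> card (free_atoms n \<gamma>')"
proof -
  \<comment> \<open>The average class size \<open>n / l\<close> is at least
    \<open>8 * q\<close>.\<close>
  have "\<exists>j\<in>{1..l}. 8 * q \<le> card (colour_class n \<gamma> j)"
  proof (rule ccontr)
    assume "\<not> ?thesis"
    then have "(\<Sum>c\<in>{1..l}. card (colour_class n \<gamma> c)) < (\<Sum>c\<in>{1..l}. 8 * q)"
      using two_le_l by (intro sum_strict_mono) (auto simp: not_le)
    then have "n < q * (8 * l)"
      unfolding sum_card_colour_class[OF \<gamma>] by (simp add: mult_ac)
    then show False
      using div_times_less_eq_dividend[of n "8 * l"] unfolding q by simp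
  qed
  then obtain j where j: "j \<in> {1..l}" "8 * q \<le> card (colour_class n \<gamma> j)" by blast
  with i have "i \<noteq> j" by auto
  obtain H where H: "H \<subseteq> colour_class n \<gamma> j" "card H = q"
    using j(2) obtain_subset_with_card_n[of q "colour_class n \<gamma> j"] by auto
  from H(1) have "finite H" by (rule finite_subset) simp
  define \<gamma>' where "\<gamma>' = (\<lambda>x. if x \<in> H then i else \<gamma> x)"
  have \<gamma>': "\<gamma>' \<in> colourings n"
    using \<gamma> H i(1) by (auto simp: \<gamma>'_def colourings_def colour_class_def PiE_iff extensional_def)
  have cls_i: "colour_class n \<gamma>' i = colour_class n \<gamma> i \<union> H"
    and cls_j: "colour_class n \<gamma>' j = colour_class n \<gamma> j - H"
    and cls: "c \<noteq> i \<Longrightarrow> c \<noteq> j \<Longrightarrow> colour_class n \<gamma>' c = colour_class n \<gamma> c" for c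
    using H(1) \<open>i \<noteq> j\<close> by (auto simp: colour_class_def \<gamma>'_def)
  have "colour_class n \<gamma> i \<inter> H = {}"
    using H(1) \<open>i \<noteq> j\<close> by (auto simp: colour_class_def)
  then have card_i: "card (colour_class n \<gamma>' i) = card (colour_class n \<gamma> i) + q"
    using H(2) \<open>finite H\<close> by (simp add: cls_i card_Un_disjoint)
  have card_j: "card (colour_class n \<gamma>' j) = card (colour_class n \<gamma> j) - q"
    using H \<open>finite H\<close> by (simp add: cls_j card_Diff_subset)
  have step: "(\<Sum>c\<in>{1..l}. clique_count k (card (colour_class n \<gamma>' c))) + q * q
      \<le> (\<Sum>c\<in>{1..l}. clique_count k (card (colour_class n \<gamma> c)))" if k: "k \<in> {1..\<rho>}" for k
  proof -
    let ?f = "\<lambda>\<gamma> c. clique_count k (card (colour_class n \<gamma> c))"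
    define a s where "a = card (colour_class n \<gamma> j)" and "s = card (colour_class n \<gamma> i)"
    have split: "sum g {1..l} = g i + g j + sum g ({1..l} - {i, j})" for g :: "nat \<Rightarrow> nat"
      using sum.subset_diff[of "{i, j}" "{1..l}" g] i(1) j(1) \<open>i \<noteq> j\<close> by simp
    have "a - q + q = a" using j(2) by (simp add: a_def)
    then have gain: "clique_count k (a - q) + clique_count k (s + q) + q * (a - q - s - r k)
        \<le> clique_count k a + clique_count k s"
      using convex_shift_gain[of "clique_count k" "r k" s "a - q" q] clique_count_convex[OF k] i(2) j(2)
      by (auto simp: a_def s_def)
    \<comment> \<open>Here \<open>a \<ge> 8 * q\<close>, while the moved set, the small class and
      the arity take at most \<open>q\<close> each.\<close>
    have "q \<le> a - q - s - r k"
      using i(2) j(2) R[OF k] by (simp add: a_def s_def)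
    then have "q * q \<le> q * (a - q - s - r k)" by (rule mult_le_mono2)
    with gain have "?f \<gamma>' i + ?f \<gamma>' j + q * q \<le> ?f \<gamma> i + ?f \<gamma> j"
      unfolding card_i card_j a_def[symmetric] s_def[symmetric] by linarith
    moreover have "sum (?f \<gamma>') ({1..l} - {i, j}) = sum (?f \<gamma>) ({1..l} - {i, j})"
      by (intro sum.cong) (auto simp: cls)
    ultimately show ?thesis
      using split[of "?f \<gamma>'"] split[of "?f \<gamma>"] by linarith
  qed
  have "(\<Sum>k\<in>{1..\<rho>}. \<Sum>c\<in>{1..l}. clique_count k (card (colour_class n \<gamma>' c))) + \<rho> * (q * q)
      = (\<Sum>k\<in>{1..\<rho>}. (\<Sum>c\<in>{1..l}. clique_count k (card (colour_class n \<gamma>' c))) + q * q)"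
    by (simp add: sum.distrib)
  also have "\<dots> \<le> (\<Sum>k\<in>{1..\<rho>}. \<Sum>c\<in>{1..l}. clique_count k (card (colour_class n \<gamma> c)))"
    by (intro sum_mono step)
  finally have "(\<Sum>k\<in>{1..\<rho>}. \<Sum>c\<in>{1..l}. clique_count k (card (colour_class n \<gamma>' c))) + \<rho> * (q * q)
      \<le> (\<Sum>k\<in>{1..\<rho>}. \<Sum>c\<in>{1..l}. clique_count k (card (colour_class n \<gamma> c)))" .
  moreover have "q * q \<le> \<rho> * (q * q)" using rho_pos by simp
  ultimately have "card (free_atoms n \<gamma>) + q * q \<le> card (free_atoms n \<gamma>')"
    using card_free_atoms[OF \<gamma>] card_free_atoms[OF \<gamma>'] by linarith
  with \<gamma>' show ?thesis by blast
qed

text \<open>The shifted colouring alone contributes its whole weight to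
  \<open>coloured_count n\<close>, so one unbalanced colouring weighs at most a
  \<open>2 ^ (q * q)\<close>-th part of the total. Several may share a shifted colouring; the crude
  count \<open>l ^ n\<close> of all colourings takes care of that.\<close>

lemma sum_unbalanced_le:
  assumes q: "q = n div (8 * l)" and R: "\<And>k. k \<in> {1..\<rho>} \<Longrightarrow> r k \<le> q"
  shows "(\<Sum>\<gamma> | \<gamma> \<in> colourings n \<and> (\<exists>i\<in>{1..l}. card (colour_class n \<gamma> i) < q).
      2 ^ card (free_atoms n \<gamma>)) \<le> (real l ^ n / 2 ^ (q * q)) * real (coloured_count n)"
    (is "sum _ ?U \<le> _")
proof -
  have "(2::real) ^ card (free_atoms n \<gamma>) \<le> real (coloured_count n) / 2 ^ (q * q)" if "\<gamma> \<in> ?U" for \<gamma>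
  proof -
    obtain \<gamma>' where \<gamma>': "\<gamma>' \<in> colourings n" "card (free_atoms n \<gamma>) + q * q \<le> card (free_atoms n \<gamma>')"
      using unbalanced_shift[OF _ q R] \<open>\<gamma> \<in> ?U\<close> by blast
    have "(2::nat) ^ (card (free_atoms n \<gamma>) + q * q) \<le> 2 ^ card (free_atoms n \<gamma>')"
      using \<gamma>'(2) by (intro power_increasing) auto
    also have "\<dots> \<le> coloured_count n"
      unfolding coloured_count_def using \<gamma>'(1) finite_colourings by (intro member_le_sum) auto
    finally have "real (2 ^ (card (free_atoms n \<gamma>) + q * q)) \<le> real (coloured_count n)"
      by (simp only: of_nat_le_iff)
    then show ?thesis by (simp add: field_simps power_add)
  qed
  then have "sum (\<lambda>\<gamma>. 2 ^ card (free_atoms n \<gamma>)) ?U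
      \<le> (\<Sum>\<gamma>\<in>?U. real (coloured_count n) / 2 ^ (q * q))"
    by (rule sum_mono)
  also have "\<dots> = real (card ?U) * (real (coloured_count n) / 2 ^ (q * q))" by simp
  also have "\<dots> \<le> real (l ^ n) * (real (coloured_count n) / 2 ^ (q * q))"
    using card_mono[OF finite_colourings[of n], of ?U]
    by (intro mult_right_mono) (auto simp: card_colourings simp flip: of_nat_power)
  finally show ?thesis by (simp add: field_simps)
qed

section \<open>Extension axioms\<close>

text \<open>
  Universes are of the form \<open>{1..n}\<close>, so \<open>0\<close> is available as a placeholder for the new element
  and as padding in the list \<open>xs\<close>.
\<close>

definition extension :: "nat \<Rightarrow> nat rel_struct \<Rightarrow> (nat \<Rightarrow> nat) \<Rightarrow> bool" where
  "extension m M \<gamma> \<longleftrightarrow>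
     (\<forall>xs j Q. set xs \<subseteq> insert 0 (universe M) \<longrightarrow> length xs = m \<longrightarrow> j \<in> {1..l} \<longrightarrow>
        (\<exists>b\<in>universe M - set xs. \<gamma> b = j \<and>
          (\<forall>k as. admissible (insert 0 (set xs)) k as \<longrightarrow> 0 \<in> set as \<longrightarrow>
             \<not> monochromatic (\<gamma>(0 := j)) (set as) \<longrightarrow>
             (map (id(0 := b)) as \<in> rel M k \<longleftrightarrow> atom k as \<in> Q))))"

text \<open>\<open>\<gamma>(0 := j)\<close> gives the placeholder the colour wanted for the new
  element. Monochromatic atoms are left out because the colouring forbids them whichever element of
  that colour is taken.\<close>

definition new_atoms :: "(nat \<Rightarrow> nat) \<Rightarrow> nat list \<Rightarrow> nat \<Rightarrow> (nat \<times> nat set \<times> nat list) set" where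
  "new_atoms \<gamma> xs j =
     {x \<in> atoms (insert 0 (set xs)). 0 \<in> supp x \<and> \<not> monochromatic (\<gamma>(0 := j)) (supp x)}"

lemma inj_on_map_atom_new:
  assumes "b \<notin> set xs"
  shows "inj_on (map_atom (id(0 := b))) (new_atoms \<gamma> xs j)"
proof (rule inj_on_inverseI)
  fix x assume "x \<in> new_atoms \<gamma> xs j"
  then have "supp x \<subseteq> insert 0 (set xs)"
    by (auto simp: new_atoms_def atoms_def dest: supp_atoms_of)
  with assms have "map_atom (id(b := 0) \<circ> id(0 := b)) x = map_atom id x"
    by (intro map_atom_cong) auto
  then show "map_atom (id(b := 0)) (map_atom (id(0 := b)) x) = x"
    by (simp add: map_atom_comp map_atom_id)
qed

text \<open>Failure is brought into the form counted by \<open>card_avoiding_subsets_le\<close>: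
  each candidate \<open>b\<close> owns a block of atoms and misses one prescribed trace on it.
  Cutting \<open>Q\<close> down to \<open>new_atoms\<close> leaves finitely many patterns.\<close>

lemma not_extension_pattern:
  assumes M: "in_class n M" and "\<not> extension m M \<gamma>"
  shows "\<exists>xs\<in>{xs. set xs \<subseteq> {0..n} \<and> length xs = m}. \<exists>j\<in>{1..l}. \<exists>Q\<in>Pow (new_atoms \<gamma> xs j).
    \<forall>b\<in>colour_class n \<gamma> j - set xs.
      diagram M \<inter> map_atom (id(0 := b)) ` new_atoms \<gamma> xs j \<noteq> map_atom (id(0 := b)) ` Q"
proof -
  have U: "universe M = {1..n}" using M by (simp add: in_class_def)
  obtain xs j Q where xs: "set xs \<subseteq> {0..n}" "length xs = m" and j: "j \<in> {1..l}"
    and none: "\<And>b. b \<in> {1..n} - set xs \<Longrightarrow> \<gamma> b = j \<Longrightarrow>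
      \<not> (\<forall>k as. admissible (insert 0 (set xs)) k as \<longrightarrow> 0 \<in> set as \<longrightarrow>
             \<not> monochromatic (\<gamma>(0 := j)) (set as) \<longrightarrow>
             (map (id(0 := b)) as \<in> rel M k \<longleftrightarrow> atom k as \<in> Q))"
    using assms(2) unfolding extension_def U by fastforce
  let ?N = "new_atoms \<gamma> xs j"
  have "diagram M \<inter> map_atom (id(0 := b)) ` ?N \<noteq> map_atom (id(0 := b)) ` (Q \<inter> ?N)"
    if b: "b \<in> colour_class n \<gamma> j - set xs" for b
  proof
    let ?\<sigma> = "id(0 := b) :: nat \<Rightarrow> nat"
    assume eq: "diagram M \<inter> map_atom ?\<sigma> ` ?N = map_atom ?\<sigma> ` (Q \<inter> ?N)"
    have "map ?\<sigma> as \<in> rel M k \<longleftrightarrow> atom k as \<in> Q"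
      if as: "admissible (insert 0 (set xs)) k as" "0 \<in> set as" "\<not> monochromatic (\<gamma>(0 := j)) (set as)"
      for k as
    proof -
      have new: "atom k as \<in> ?N"
        using as by (auto simp: new_atoms_def atom_in_atoms)
      have "inj_on ?\<sigma> (insert 0 (set xs))" using b by (auto simp: inj_on_def)
      then have "inj_on ?\<sigma> (set as)"
        by (rule inj_on_subset) (use as(1) in \<open>simp add: admissible_def\<close>)
      then have "admissible {1..n} k (map ?\<sigma> as)"
        using as(1) b xs(1) by (auto simp: admissible_def distinct_map colour_class_def)
      then have "map ?\<sigma> as \<in> rel M k \<longleftrightarrow> map_atom ?\<sigma> (atom k as) \<in> diagram M"
        using rel_iff_diagram[OF M] by (simp add: map_atom_atom)
      also have "\<dots> \<longleftrightarrow> map_atom ?\<sigma> (atom k as) \<in> map_atom ?\<sigma> ` (Q \<inter> ?N)"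
        using new eq by blast
      also have "\<dots> \<longleftrightarrow> atom k as \<in> Q \<inter> ?N"
        using inj_on_image_mem_iff[OF inj_on_map_atom_new new, of b "Q \<inter> ?N"] b by auto
      finally show ?thesis using new by blast
    qed
    moreover have "b \<in> {1..n} - set xs" "\<gamma> b = j" using b by (auto simp: colour_class_def)
    ultimately show False using none by blast
  qed
  then show ?thesis
    using xs j by (intro bexI[of _ xs] bexI[of _ j] bexI[of _ "Q \<inter> ?N"]) auto
qed

text \<open>A union bound: \<open>(n + 1) ^ m\<close> lists over \<open>{0..n}\<close>,
  \<open>l\<close> colours, at most \<open>2 ^ c\<close> patterns on at most \<open>c\<close> new
  atoms, and for each of these at least \<open>q - m\<close> candidates of the right colour outside
  the list.\<close>

lemma card_not_extension_le:
  assumes n: "n \<ge> 1" and \<gamma>: "\<gamma> \<in> colourings n"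
    and balanced: "\<And>j. j \<in> {1..l} \<Longrightarrow> q \<le> card (colour_class n \<gamma> j)"
    and c: "c = (\<Sum>k=1..\<rho>. Suc m ^ r k)"
  shows "real (card {M \<in> coloured_by n \<gamma>. \<not> extension m M \<gamma>})
    \<le> real ((n + 1) ^ m * l * 2 ^ c) * ((1 - 1 / 2 ^ c) ^ (q - m)) * 2 ^ card (free_atoms n \<gamma>)"
proof -
  define L where "L = {xs. set xs \<subseteq> {0..n} \<and> length xs = m}"
  define F where "F xs j Q = {T \<in> Pow (free_atoms n \<gamma>). \<forall>b\<in>colour_class n \<gamma> j - set xs.
      T \<inter> map_atom (id(0 := b)) ` new_atoms \<gamma> xs j \<noteq> map_atom (id(0 := b)) ` Q}" for xs j Q
  define e :: real where "e = 2 ^ card (free_atoms n \<gamma>) * (1 - 1 / 2 ^ c) ^ (q - m)"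
  have card_L: "card L = (n + 1) ^ m" and fin_L: "finite L"
    by (simp_all add: L_def card_lists_length_eq finite_lists_length_eq)
  have card_new: "card (new_atoms \<gamma> xs j) \<le> c" and fin_new: "finite (new_atoms \<gamma> xs j)" if "xs \<in> L" for xs j
  proof -
    have "card (insert 0 (set xs)) \<le> Suc m"
      using that card_length[of "0 # xs"] by (simp add: L_def)
    then have "card (atoms (insert 0 (set xs))) \<le> c"
      using card_atoms_le c by blast
    moreover have "new_atoms \<gamma> xs j \<subseteq> atoms (insert 0 (set xs))" "finite (atoms (insert 0 (set xs)))"
      by (auto simp: new_atoms_def finite_atoms)
    ultimately show "card (new_atoms \<gamma> xs j) \<le> c" "finite (new_atoms \<gamma> xs j)"
      using card_mono finite_subset by (metis order_trans)+
  qed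
  have F_le: "real (card (F xs j Q)) \<le> e"
    if xs: "xs \<in> L" and j: "j \<in> {1..l}" and Q: "Q \<in> Pow (new_atoms \<gamma> xs j)" for xs j Q
  proof -
    let ?J = "colour_class n \<gamma> j - set xs"
    let ?B = "\<lambda>b. map_atom (id(0 := b)) ` new_atoms \<gamma> xs j"
    have "real (card (F xs j Q)) \<le> 2 ^ card (free_atoms n \<gamma>) * (1 - 1 / 2 ^ c) ^ card ?J"
      unfolding F_def
    proof (rule card_avoiding_subsets_le)
      show "?B b \<subseteq> free_atoms n \<gamma>" if b: "b \<in> ?J" for b
      proof
        fix y assume "y \<in> ?B b"
        then obtain k as where y: "y = atom k (map (id(0 := b)) as)"
          and as: "admissible (insert 0 (set xs)) k as" "\<not> monochromatic (\<gamma>(0 := j)) (set as)"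
          by (auto simp: new_atoms_def map_atom_atom elim!: atomsE)
        have "inj_on (id(0 := b)) (insert 0 (set xs))" using b by (auto simp: inj_on_def)
        then have "inj_on (id(0 := b)) (set as)"
          by (rule inj_on_subset) (use as(1) in \<open>simp add: admissible_def\<close>)
        then have "admissible {1..n} k (map (id(0 := b)) as)"
          using as(1) b xs by (auto simp: L_def admissible_def distinct_map colour_class_def)
        moreover have "monochromatic \<gamma> (set (map (id(0 := b)) as)) \<longleftrightarrow> monochromatic (\<gamma>(0 := j)) (set as)"
          unfolding set_map monochromatic_image
          using b by (intro monochromatic_cong) (auto simp: colour_class_def)
        ultimately show "y \<in> free_atoms n \<gamma>"
          using as(2) y by (simp add: free_atoms_def atom_in_atoms)
      qed
      show "card (?B b) \<le> c" for b
        using card_new[OF xs, of j] card_image_le[OF fin_new[OF xs, of j]] order_trans by blast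
      \<comment> \<open>Atoms in the block of \<open>b\<close> contain \<open>b\<close>, whereas
        those in the block of \<open>b'\<close> live on \<open>b'\<close> and the list.\<close>
      show "disjoint_family_on ?B ?J"
        unfolding disjoint_family_on_def
      proof (intro ballI impI)
        fix b b' assume b: "b \<in> ?J" "b' \<in> ?J" "b \<noteq> b'"
        have "b \<in> supp y" if "y \<in> ?B b" for y b
          using that by (force simp: new_atoms_def supp_map_atom)
        moreover have "supp y \<subseteq> insert b' (set xs)" if "y \<in> ?B b'" for y b'
          using that by (force simp: new_atoms_def supp_map_atom atoms_def dest: supp_atoms_of)
        ultimately show "?B b \<inter> ?B b' = {}" using b by blast
      qed
    qed (use Q finite_free_atoms in auto)
    also have "\<dots> \<le> e"
    proof -
      have "card (set xs) \<le> m" using xs card_length[of xs] by (simp add: L_def)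
      then have "q - m \<le> card ?J"
        using balanced[OF j] diff_card_le_card_Diff[of "set xs" "colour_class n \<gamma> j"] by simp
      then show ?thesis unfolding e_def
        by (intro mult_left_mono power_decreasing) auto
    qed
    finally show ?thesis .
  qed
  let ?bad = "{M \<in> coloured_by n \<gamma>. \<not> extension m M \<gamma>}"
  let ?F = "\<Union>xs\<in>L. \<Union>j\<in>{1..l}. \<Union>Q\<in>Pow (new_atoms \<gamma> xs j). F xs j Q"
  have diag: "diagram M \<in> Pow (free_atoms n \<gamma>)" if "M \<in> coloured_by n \<gamma>" for M
    using bij_betw_apply[OF bij_betw_diagram[OF n \<gamma>] that] .
  have "diagram ` ?bad \<subseteq> ?F"
  proof
    fix T assume "T \<in> diagram ` ?bad"
    then obtain M where M: "M \<in> coloured_by n \<gamma>" "\<not> extension m M \<gamma>" "T = diagram M" by blast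
    then have "in_class n M" by (simp add: coloured_by_def)
    from not_extension_pattern[OF this M(2)] diag[OF M(1)] M(3) show "T \<in> ?F"
      unfolding L_def F_def by blast
  qed
  moreover have "finite ?F"
    using fin_L fin_new finite_free_atoms by (auto simp: F_def)
  moreover have "inj_on diagram ?bad"
    using bij_betw_diagram[OF n \<gamma>] by (auto simp: bij_betw_def intro: inj_on_subset)
  ultimately have "card ?bad \<le> card ?F"
    using card_mono[of ?F "diagram ` ?bad"] by (simp add: card_image)
  also have "\<dots> \<le> (\<Sum>xs\<in>L. \<Sum>j\<in>{1..l}. \<Sum>Q\<in>Pow (new_atoms \<gamma> xs j). card (F xs j Q))"
    using fin_L fin_new
    by (intro order_trans[OF card_UN_le] sum_mono) auto
  finally have "real (card ?bad) \<le> (\<Sum>xs\<in>L. \<Sum>j\<in>{1..l}. \<Sum>Q\<in>Pow (new_atoms \<gamma> xs j). real (card (F xs j Q)))"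
    by (simp flip: of_nat_sum)
  also have "\<dots> \<le> (\<Sum>xs\<in>L. \<Sum>j\<in>{1..l}. \<Sum>Q\<in>Pow (new_atoms \<gamma> xs j). e)"
    by (intro sum_mono F_le)
  also have "\<dots> \<le> (\<Sum>xs\<in>L. \<Sum>j\<in>{1..l}. 2 ^ c * e)"
  proof (intro sum_mono)
    fix xs j assume "xs \<in> L"
    have "(\<Sum>Q\<in>Pow (new_atoms \<gamma> xs j). e) = 2 ^ card (new_atoms \<gamma> xs j) * e"
      using fin_new[OF \<open>xs \<in> L\<close>] by (simp add: card_Pow)
    also have "\<dots> \<le> 2 ^ c * e"
      using card_new[OF \<open>xs \<in> L\<close>] by (intro mult_right_mono power_increasing) (auto simp: e_def)
    finally show "(\<Sum>Q\<in>Pow (new_atoms \<gamma> xs j). e) \<le> 2 ^ c * e" .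
  qed
  also have "\<dots> = real ((n + 1) ^ m * l * 2 ^ c) * e"
    by (simp add: card_L)
  finally show ?thesis by (simp add: e_def mult_ac)
qed

lemma extension_set:
  assumes "in_class n M" "extension m M \<gamma>" "X \<subseteq> {1..n}" "card X \<le> m" "j \<in> {1..l}"
  shows "\<exists>b\<in>{1..n} - X. \<gamma> b = j \<and>
    (\<forall>k as. admissible (insert 0 X) k as \<longrightarrow> 0 \<in> set as \<longrightarrow> \<not> monochromatic (\<gamma>(0 := j)) (set as) \<longrightarrow>
       (map (id(0 := b)) as \<in> rel M k \<longleftrightarrow> atom k as \<in> Q))"
proof -
  have U: "universe M = {1..n}" using assms(1) by (simp add: in_class_def)
  have "finite X" using assms(3) finite_subset by auto
  then obtain xs where xs: "length xs = m" "X \<subseteq> set xs" "set xs \<subseteq> insert 0 X"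
    using exists_padded_list[OF _ assms(4)] by blast
  then have eq: "insert 0 (set xs) = insert 0 X" by blast
  have "set xs \<subseteq> insert 0 {1..n}" using xs(3) assms(3) by blast
  then obtain b where "b \<in> {1..n} - set xs" "\<gamma> b = j"
    "\<forall>k as. admissible (insert 0 (set xs)) k as \<longrightarrow> 0 \<in> set as \<longrightarrow>
       \<not> monochromatic (\<gamma>(0 := j)) (set as) \<longrightarrow> (map (id(0 := b)) as \<in> rel M k \<longleftrightarrow> atom k as \<in> Q)"
    using assms(2,5) xs(1) unfolding extension_def U by blast
  then show ?thesis using xs(2) unfolding eq by blast
qed

text \<open>The pattern \<open>Q = UNIV\<close>: the new element joins every tuple that the
  colouring permits. Renaming \<open>b\<close> to \<open>0\<close> can be undone because
  \<open>0\<close> lies outside the universe.\<close>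

lemma extension_full:
  assumes M: "in_class n M" "extension m M \<gamma>" and X: "X \<subseteq> {1..n}" "card X \<le> m" and j: "j \<in> {1..l}"
  shows "\<exists>b\<in>{1..n} - X. \<gamma> b = j \<and>
    (\<forall>k as. admissible (insert b X) k as \<longrightarrow> b \<in> set as \<longrightarrow> \<not> monochromatic \<gamma> (set as) \<longrightarrow> as \<in> rel M k)"
proof -
  obtain b where b: "b \<in> {1..n} - X" "\<gamma> b = j"
    and ext: "\<And>k as. admissible (insert 0 X) k as \<Longrightarrow> 0 \<in> set as \<Longrightarrow>
      \<not> monochromatic (\<gamma>(0 := j)) (set as) \<Longrightarrow> map (id(0 := b)) as \<in> rel M k"
    using extension_set[OF M X j, of UNIV] by auto
  have "as \<in> rel M k"
    if as: "admissible (insert b X) k as" "b \<in> set as" "\<not> monochromatic \<gamma> (set as)" for k as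
  proof -
    let ?as = "map (id(b := 0)) as"
    have sub: "set as \<subseteq> insert b X" using as(1) by (simp add: admissible_def)
    have "0 \<notin> X" using X(1) by auto
    have "inj_on (id(b := 0)) (set as)"
      using sub \<open>0 \<notin> X\<close> by (auto simp: inj_on_def intro!: gr0I)
    then have "admissible (insert 0 X) k ?as"
      using as(1) by (auto simp: admissible_def distinct_map)
    moreover have "monochromatic (\<gamma>(0 := j)) (set ?as) \<longleftrightarrow> monochromatic \<gamma> (set as)"
      unfolding set_map monochromatic_image
      using sub b \<open>0 \<notin> X\<close> by (intro monochromatic_cong) auto
    ultimately have "map (id(0 := b)) ?as \<in> rel M k"
      using ext[of k ?as] as(2,3) by force
    moreover have "map (id(0 := b)) ?as = as"
      unfolding map_map by (rule map_idI) (use sub \<open>0 \<notin> X\<close> in \<open>auto intro!: gr0I\<close>)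
    ultimately show ?thesis by simp
  qed
  with b show ?thesis by blast
qed

section \<open>A gadget with a unique colouring\<close>

text \<open>
  The gadget is a complete \<open>l\<close>-partite configuration with large parts. By the pigeonhole
  principle, in every colouring each part contains \<open>r 1 - 1\<close> vertices of equal colour, and that
  colour is then forbidden for all other parts. Vertices \<open>0\<close> and \<open>1\<close> are the free variables:
  \<open>0\<close> lies in part \<open>0\<close> and \<open>1\<close> in part \<open>p\<close>.
\<close>

definition gadget_size :: nat where
  "gadget_size = l * (l * r 1 + 1)"

definition part :: "nat \<Rightarrow> nat \<Rightarrow> nat" where
  "part p v = (if v = 0 then 0 else if v = 1 then p else v mod l)"

text \<open>The tail \<open>vs\<close> avoids \<open>0\<close> and \<open>1\<close>, so a tuple
  never holds both free vertices. Gadgets thus exist also for \<open>a = b\<close>, even if symbol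
  \<open>1\<close> is irreflexive.\<close>

definition gadget_tuples :: "nat \<Rightarrow> nat list set" where
  "gadget_tuples p = {u # vs | u vs. length (u # vs) = r 1 \<and> u < gadget_size \<and> distinct vs \<and>
     set vs \<subseteq> {2..<gadget_size} \<and> (\<exists>i. part p u \<noteq> i \<and> (\<forall>v\<in>set vs. part p v = i))}"

text \<open>Pigeonholing happens among gadget vertices, not their images, so \<open>z\<close> may
  identify vertices and the condition stays a conjunction of relational atoms.\<close>

definition gadget :: "nat \<Rightarrow> nat rel_struct \<Rightarrow> (nat \<Rightarrow> nat) \<Rightarrow> bool" where
  "gadget p M z \<longleftrightarrow> (\<forall>v<gadget_size. z v \<in> universe M) \<and> (\<forall>xs\<in>gadget_tuples p. map z xs \<in> rel M 1)"

lemma one_in_vocabulary: "1 \<in> {1..\<rho>}"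
  using rho_pos by simp

lemma two_le_gadget_size: "2 \<le> gadget_size"
  using two_le_l by (simp add: gadget_size_def)

lemma gadget_part_colour:
  assumes \<gamma>: "colouring \<rho> l M \<gamma>" and z: "gadget p M z" and i: "i < l"
  shows "\<exists>c\<in>{1..l}. (\<exists>v<gadget_size. part p v = i \<and> \<gamma> (z v) = c) \<and>
    (\<forall>u<gadget_size. part p u \<noteq> i \<longrightarrow> \<gamma> (z u) \<noteq> c)"
proof -
  \<comment> \<open>Starting at \<open>t = 1\<close> stays clear of \<open>0\<close> and
    \<open>1\<close>, whose parts are assigned separately; \<open>gadget_size\<close> leaves room
    for \<open>l * r 1\<close> such vertices in each residue class.\<close>
  let ?V = "(\<lambda>t. i + l * t) ` {1..l * r 1}"
  have r1: "r 1 \<ge> 2" using arity[OF one_in_vocabulary] .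
  have V: "v < gadget_size \<and> 2 \<le> v \<and> part p v = i" if v: "v \<in> ?V" for v
  proof -
    from v obtain t where "v = i + l * t" "t \<in> {1..l * r 1}" by (rule imageE)
    then have t: "v = i + l * t" "1 \<le> t" "t \<le> l * r 1" by auto
    have "l \<le> l * t" using t(2) by simp
    moreover have "l * t \<le> l * (l * r 1)" using t(3) by (rule mult_le_mono2)
    ultimately have "v < gadget_size" "2 \<le> v"
      unfolding gadget_size_def t(1) distrib_left using i two_le_l by linarith+
    moreover have "v mod l = i" using t(1) i by simp
    ultimately show ?thesis by (simp add: part_def)
  qed
  have col: "\<gamma> (z v) \<in> {1..l}" if "v < gadget_size" for v
    using that \<gamma> z by (auto simp: gadget_def colouring_def)
  have "inj_on (\<lambda>t. i + l * t) {1..l * r 1}" using two_le_l by (auto simp: inj_on_def)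
  then have card_V: "card ?V = l * r 1" by (simp add: card_image)
  have "\<exists>c\<in>{1..l}. r 1 \<le> card {v \<in> ?V. \<gamma> (z v) = c}"
  proof (rule ccontr)
    assume *: "\<not> ?thesis"
    have "\<gamma> (z v) \<in> {1..l}" if "v \<in> ?V" for v using V[OF that] col by blast
    then have "?V = (\<Union>c\<in>{1..l}. {v \<in> ?V. \<gamma> (z v) = c})" by blast
    then have "card ?V = card (\<Union>c\<in>{1..l}. {v \<in> ?V. \<gamma> (z v) = c})" by (rule arg_cong)
    also have "\<dots> \<le> (\<Sum>c\<in>{1..l}. card {v \<in> ?V. \<gamma> (z v) = c})"
      by (rule card_UN_le) simp
    also have "\<dots> < (\<Sum>c\<in>{1..l}. r 1)"
      using * two_le_l by (intro sum_strict_mono) (auto simp: not_le)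
    finally show False using card_V by simp
  qed
  then obtain c where c: "c \<in> {1..l}" "r 1 \<le> card {v \<in> ?V. \<gamma> (z v) = c}" by blast
  then have "r 1 - 1 \<le> card {v \<in> ?V. \<gamma> (z v) = c}" by linarith
  then obtain W where W: "W \<subseteq> {v \<in> ?V. \<gamma> (z v) = c}" "card W = r 1 - 1" "finite W"
    by (rule obtain_subset_with_card_n)
  then obtain vs where vs: "set vs = W" "distinct vs" "length vs = r 1 - 1"
    by (metis finite_distinct_list distinct_card)
  have "\<gamma> (z u) \<noteq> c" if u: "u < gadget_size" "part p u \<noteq> i" for u
  proof
    assume "\<gamma> (z u) = c"
    have "set vs \<subseteq> {2..<gadget_size}" "\<forall>v\<in>set vs. part p v = i"
      using W(1) V unfolding vs(1) by fastforce+
    then have "u # vs \<in> gadget_tuples p"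
      using u vs r1 by (auto simp: gadget_tuples_def)
    then have "map z (u # vs) \<in> rel M 1" using z by (auto simp: gadget_def)
    then have "\<not> monochromatic \<gamma> (set (map z (u # vs)))"
      using \<gamma> one_in_vocabulary unfolding colouring_iff by blast
    moreover have "monochromatic \<gamma> (set (map z (u # vs)))"
      unfolding monochromatic_def using W(1) vs(1) \<open>\<gamma> (z u) = c\<close> by (intro exI[of _ c]) auto
    ultimately show False by simp
  qed
  moreover have "\<exists>v<gadget_size. part p v = i \<and> \<gamma> (z v) = c"
  proof -
    have "W \<noteq> {}" using W(2) r1 by auto
    then show ?thesis using W(1) V by blast
  qed
  ultimately show ?thesis using c(1) by blast
qed

text \<open>Each of the \<open>l\<close> parts owns a colour that all other parts avoid. These
  \<open>l\<close> colours are distinct, hence all there are, and a vertex is left with the colour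
  of its own part.\<close>

lemma gadget_colouring:
  assumes \<gamma>: "colouring \<rho> l M \<gamma>" and z: "gadget p M z" and p: "p < l"
    and uv: "u < gadget_size" "v < gadget_size"
  shows "\<gamma> (z u) = \<gamma> (z v) \<longleftrightarrow> part p u = part p v"
proof -
  obtain c where c: "\<And>i. i < l \<Longrightarrow> c i \<in> {1..l}"
    and occurs: "\<And>i. i < l \<Longrightarrow> \<exists>v<gadget_size. part p v = i \<and> \<gamma> (z v) = c i"
    and avoids: "\<And>i u. i < l \<Longrightarrow> u < gadget_size \<Longrightarrow> part p u \<noteq> i \<Longrightarrow> \<gamma> (z u) \<noteq> c i"
    using gadget_part_colour[OF \<gamma> z] by metis
  have inj: "inj_on c {..<l}"
  proof (rule inj_onI)
    fix i i' assume "i \<in> {..<l}" "i' \<in> {..<l}" "c i = c i'"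
    then show "i = i'" using occurs[of i] avoids[of i'] by fastforce
  qed
  then have surj: "c ` {..<l} = {1..l}"
    using c by (intro card_subset_eq) (auto simp: card_image)
  have eq: "\<gamma> (z u) = c (part p u)" if "u < gadget_size" for u
  proof -
    have "\<gamma> (z u) \<in> {1..l}" using that \<gamma> z by (auto simp: gadget_def colouring_def)
    then obtain i where "i < l" "\<gamma> (z u) = c i" unfolding surj[symmetric] by auto
    then show ?thesis using avoids[of i u] that by auto
  qed
  have "part p w < l" for w using p two_le_l by (auto simp: part_def)
  then show ?thesis using eq[OF uv(1)] eq[OF uv(2)] inj by (auto simp: inj_on_def)
qed

text \<open>Greedy choice by \<open>extension_full\<close>, each vertex joining all permitted tuples
  with its predecessors. Vertex \<open>v\<close> has at most \<open>v\<close> predecessors, so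
  \<open>N \<le> Suc m\<close> keeps every choice within reach of the extension property.\<close>

lemma extension_sequence:
  assumes M: "in_class n M" "extension m M \<gamma>"
    and ab: "a \<in> {1..n}" "b \<in> {1..n}" and col: "\<And>v. col v \<in> {1..l}"
    and N: "2 \<le> N" "N \<le> Suc m"
  shows "\<exists>z. z 0 = a \<and> z 1 = b \<and> (\<forall>v. 2 \<le> v \<longrightarrow> v < N \<longrightarrow>
    z v \<in> {1..n} \<and> z v \<notin> z ` {..<v} \<and> \<gamma> (z v) = col v \<and>
    (\<forall>k as. admissible (z ` {..v}) k as \<longrightarrow> z v \<in> set as \<longrightarrow> \<not> monochromatic \<gamma> (set as) \<longrightarrow> as \<in> rel M k))"
  using N
proof (induction N rule: dec_induct)
  case base
  show ?case by (intro exI[of _ "\<lambda>v. if v = 0 then a else b"]) auto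
next
  case (step N)
  then obtain z where z: "z 0 = a" "z 1 = b"
    and zv: "\<And>v. 2 \<le> v \<Longrightarrow> v < N \<Longrightarrow> z v \<in> {1..n} \<and> z v \<notin> z ` {..<v} \<and> \<gamma> (z v) = col v \<and>
    (\<forall>k as. admissible (z ` {..v}) k as \<longrightarrow> z v \<in> set as \<longrightarrow> \<not> monochromatic \<gamma> (set as) \<longrightarrow> as \<in> rel M k)"
    by (metis Suc_leD)
  have "z v \<in> {1..n}" if "v < N" for v
    using that zv[of v] z ab by (cases "v = 0 \<or> v = 1") auto
  then have sub: "z ` {..<N} \<subseteq> {1..n}" by blast
  have card: "card (z ` {..<N}) \<le> m"
    using card_image_le[of "{..<N}" z] step.prems by simp
  from extension_full[OF M sub card col[of N]] obtain w where w: "w \<in> {1..n} - z ` {..<N}" "\<gamma> w = col N"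
    and full: "\<forall>k as. admissible (insert w (z ` {..<N})) k as \<longrightarrow> w \<in> set as \<longrightarrow>
      \<not> monochromatic \<gamma> (set as) \<longrightarrow> as \<in> rel M k"
    by blast
  let ?z = "z(N := w)"
  have img: "?z ` {..<v} = z ` {..<v}" if "v \<le> N" for v
    using that by (intro image_cong) auto
  have img': "?z ` {..v} = z ` {..v}" if "v < N" for v
    using that by (intro image_cong) auto
  have img'': "?z ` {..N} = insert w (z ` {..<N})"
    by (auto simp: lessThan_Suc_atMost[symmetric] lessThan_Suc)
  show ?case
  proof (intro exI[of _ ?z] conjI allI impI)
    fix v assume v: "2 \<le> v" "v < Suc N"
    show "?z v \<in> {1..n}" "?z v \<notin> ?z ` {..<v}" "\<gamma> (?z v) = col v"
      using zv[OF v(1)] v w img[of v] by (cases "v = N"; auto)+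
    fix k as assume "admissible (?z ` {..v}) k as" "?z v \<in> set as" "\<not> monochromatic \<gamma> (set as)"
    then show "as \<in> rel M k"
      using zv[OF v(1)] v full img'[of v] img'' by (cases "v = N") auto
  qed (use z step.hyps in auto)
qed

text \<open>The part \<open>p\<close> of the second free vertex is the one whose colour is that of
  \<open>b\<close>. With \<open>p = 0\<close> the gadget forces equal colours in every colouring,
  with any other \<open>p\<close> it forces different ones.\<close>

lemma gadget_exists:
  assumes M: "in_class n M" "extension m M \<gamma>" and m: "gadget_size \<le> m"
    and \<gamma>: "colouring \<rho> l M \<gamma>" and ab: "a \<in> {1..n}" "b \<in> {1..n}"
  shows "\<exists>p<l. (p = 0 \<longleftrightarrow> \<gamma> a = \<gamma> b) \<and> (\<exists>z. z 0 = a \<and> z 1 = b \<and> gadget p M z)"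
proof -
  have U: "universe M = {1..n}" using M(1) by (simp add: in_class_def)
  have \<gamma>ab: "\<gamma> a \<in> {1..l}" "\<gamma> b \<in> {1..l}" using \<gamma> ab U by (auto simp: colouring_def)
  \<comment> \<open>The enumeration \<open>i \<mapsto> Suc i\<close> of the colours with the values
    \<open>1\<close> and \<open>\<gamma> a\<close> exchanged, so that part \<open>0\<close> receives
    the colour of \<open>a\<close>.\<close>
  define h where "h i = (if i = 0 then \<gamma> a else if i = \<gamma> a - 1 then 1 else Suc i)" for i
  have inj: "inj_on h {..<l}" using \<gamma>ab(1) by (auto simp: inj_on_def h_def split: if_splits)
  moreover have "h ` {..<l} \<subseteq> {1..l}" using \<gamma>ab(1) by (auto simp: h_def)
  ultimately have bij: "h ` {..<l} = {1..l}"
    by (intro card_subset_eq) (auto simp: card_image)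
  obtain p where p: "p < l" "h p = \<gamma> b" using \<gamma>ab(2) unfolding bij[symmetric] by force
  have h0: "h 0 = \<gamma> a" by (simp add: h_def)
  have "p = 0 \<longleftrightarrow> \<gamma> a = \<gamma> b"
    using inj_onD[OF inj, of p 0] p h0 two_le_l by auto
  define col where "col v = h (v mod l)" for v
  have col: "col v \<in> {1..l}" for v
    unfolding col_def bij[symmetric] using two_le_l by (intro imageI) simp
  have "gadget_size \<le> Suc m" using m by simp
  from extension_sequence[of n M m \<gamma> a b col, OF M ab col two_le_gadget_size this]
  obtain z where z: "z 0 = a" "z 1 = b"
    and zv: "\<And>v. 2 \<le> v \<Longrightarrow> v < gadget_size \<Longrightarrow> z v \<in> {1..n} \<and> z v \<notin> z ` {..<v} \<and> \<gamma> (z v) = col v \<and>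
    (\<forall>k as. admissible (z ` {..v}) k as \<longrightarrow> z v \<in> set as \<longrightarrow> \<not> monochromatic \<gamma> (set as) \<longrightarrow> as \<in> rel M k)"
    by blast
  have zU: "z v \<in> {1..n}" if "v < gadget_size" for v
    using that zv[of v] z ab by (cases "v = 0 \<or> v = 1") auto
  have z\<gamma>: "\<gamma> (z v) = h (part p v)" if "v < gadget_size" for v
    using that zv[of v] z p(2) h0 by (cases "v = 0 \<or> v = 1") (auto simp: part_def col_def)
  have part_less: "part p v < l" for v using p(1) two_le_l by (auto simp: part_def)
  have "map z xs \<in> rel M 1" if tuple: "xs \<in> gadget_tuples p" for xs
  proof -
    obtain u vs i where xs: "xs = u # vs" "length (u # vs) = r 1" "u < gadget_size" "distinct vs"
      "set vs \<subseteq> {2..<gadget_size}" "part p u \<noteq> i" "\<forall>v\<in>set vs. part p v = i"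
      using tuple by (auto simp: gadget_tuples_def)
    have "vs \<noteq> []" using xs(2) arity[OF one_in_vocabulary] by auto
    then obtain v where v: "v \<in> set vs" by (cases vs) auto
    \<comment> \<open>\<open>w\<close> is the entry chosen last; the extension property used for it
      covers the whole tuple.\<close>
    define w where "w = Max (set xs)"
    have w: "w \<in> set xs" "\<And>x. x \<in> set xs \<Longrightarrow> x \<le> w"
      unfolding w_def using Max_in[of "set xs"] xs(1) by auto
    have "2 \<le> w" using w(2)[of v] v xs(1,5) by auto
    have small: "x < gadget_size" if "x \<in> set xs" for x
      using that xs(1,3,5) by auto
    \<comment> \<open>Only the vertices \<open>0\<close> and \<open>1\<close> can share an image,
      and no tuple contains both.\<close>
    have ne: "z x \<noteq> z y" if "x \<in> set xs" "y \<in> set xs" "x < y" for x y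
    proof -
      have "2 \<le> y"
      proof (rule ccontr)
        assume "\<not> 2 \<le> y"
        then have "x \<notin> set vs" "y \<notin> set vs" using that(3) xs(5) by auto
        then show False using that xs(1) by auto
      qed
      then have "z y \<notin> z ` {..<y}" using zv[of y] small[OF that(2)] by blast
      then show ?thesis using that(3) by (metis imageI lessThan_iff)
    qed
    then have "inj_on z (set xs)" by (metis inj_onI linorder_neqE_nat)
    moreover have "distinct xs" using xs(1,4,6,7) by auto
    ultimately have "distinct (map z xs)" by (simp add: distinct_map)
    then have "admissible (z ` {..w}) 1 (map z xs)"
      using xs(1,2) w(2) one_in_vocabulary by (auto simp: admissible_def)
    moreover have "\<not> monochromatic \<gamma> (set (map z xs))"
    proof
      assume "monochromatic \<gamma> (set (map z xs))"
      then have "h (part p u) = h (part p v)"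
        using z\<gamma>[of u] z\<gamma>[of v] small v xs(1) by (auto simp: monochromatic_def)
      then have "part p u = part p v" using inj part_less by (auto simp: inj_on_def)
      then show False using v xs(6,7) by auto
    qed
    ultimately show ?thesis using zv[OF \<open>2 \<le> w\<close> small[OF w(1)]] w(1) by auto
  qed
  then have "gadget p M z" using zU by (simp add: gadget_def U)
  with p(1) \<open>p = 0 \<longleftrightarrow> \<gamma> a = \<gamma> b\<close> z show ?thesis by blast
qed

lemma extension_unique_colouring:
  assumes M: "in_class n M" "extension m M \<gamma>" "gadget_size \<le> m" "colouring \<rho> l M \<gamma>"
    and \<gamma>': "colouring \<rho> l M \<gamma>'" and ab: "a \<in> {1..n}" "b \<in> {1..n}"
  shows "\<gamma>' a = \<gamma>' b \<longleftrightarrow> \<gamma> a = \<gamma> b"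
proof -
  obtain p z where p: "p < l" "p = 0 \<longleftrightarrow> \<gamma> a = \<gamma> b" and z: "z 0 = a" "z 1 = b" "gadget p M z"
    using gadget_exists[OF M ab] by blast
  have "\<gamma>' (z 0) = \<gamma>' (z 1) \<longleftrightarrow> part p 0 = part p 1"
    using two_le_gadget_size by (intro gadget_colouring[OF \<gamma>' z(3) p(1)]) auto
  then show ?thesis using p(2) z(1,2) by (auto simp: part_def)
qed

lemma extension_gadget_iff:
  assumes M: "in_class n M" "extension m M \<gamma>" "gadget_size \<le> m" "colouring \<rho> l M \<gamma>"
    and ab: "a \<in> {1..n}" "b \<in> {1..n}"
  shows "(\<exists>z. z 0 = a \<and> z 1 = b \<and> gadget 0 M z) \<longleftrightarrow> \<gamma> a = \<gamma> b"
proof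
  assume "\<exists>z. z 0 = a \<and> z 1 = b \<and> gadget 0 M z"
  then obtain z where z: "z 0 = a" "z 1 = b" "gadget 0 M z" by blast
  have "\<gamma> (z 0) = \<gamma> (z 1) \<longleftrightarrow> part 0 0 = part 0 1"
    using two_le_gadget_size two_le_l by (intro gadget_colouring[OF M(4) z(3)]) auto
  then show "\<gamma> a = \<gamma> b" using z by (simp add: part_def)
qed (use gadget_exists[OF M ab] in blast)

section \<open>Writing the gadget as a formula in two free variables\<close>

lemma finite_gadget_tuples: "finite (gadget_tuples p)"
proof (rule finite_subset)
  show "gadget_tuples p \<subseteq> {xs. set xs \<subseteq> {..<gadget_size} \<and> length xs = r 1}"
    by (fastforce simp: gadget_tuples_def)
qed (simp add: finite_lists_length_eq)

text \<open>\<open>Eq 0 0\<close> serves as truth. It makes variable \<open>0\<close> occur free,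
  which is harmless because \<open>0\<close> is one of the two variables of the intended
  formula.\<close>

lemma sat_foldr_Conj: "sat M e (foldr Conj \<phi>s (Eq 0 0)) \<longleftrightarrow> (\<forall>\<phi>\<in>set \<phi>s. sat M e \<phi>)"
  by (induction \<phi>s) auto

lemma fv_foldr_Conj: "fv (foldr Conj \<phi>s (Eq 0 0)) = insert 0 (\<Union>\<phi>\<in>set \<phi>s. fv \<phi>)"
  by (induction \<phi>s) auto

lemma is_fm_foldr_Conj: "is_fm \<rho> r (foldr Conj \<phi>s (Eq 0 0)) \<longleftrightarrow> (\<forall>\<phi>\<in>set \<phi>s. is_fm \<rho> r \<phi>)"
  by (induction \<phi>s) auto

lemma fv_foldr_Ex: "fv (foldr Ex vs \<phi>) = fv \<phi> - set vs"
  by (induction vs) auto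

lemma is_fm_foldr_Ex: "is_fm \<rho> r (foldr Ex vs \<phi>) \<longleftrightarrow> is_fm \<rho> r \<phi>"
  by (induction vs) auto

lemma sat_foldr_Ex:
  assumes "distinct vs"
  shows "sat M e (foldr Ex vs \<phi>) \<longleftrightarrow>
    (\<exists>z. (\<forall>v. v \<notin> set vs \<longrightarrow> z v = e v) \<and> (\<forall>v\<in>set vs. z v \<in> universe M) \<and> sat M z \<phi>)"
  using assms
proof (induction vs arbitrary: e)
  case Nil
  then show ?case by (auto simp: fun_eq_iff[symmetric])
next
  case (Cons x vs)
  then have IH: "sat M e' (foldr Ex vs \<phi>) \<longleftrightarrow>
    (\<exists>z. (\<forall>v. v \<notin> set vs \<longrightarrow> z v = e' v) \<and> (\<forall>v\<in>set vs. z v \<in> universe M) \<and> sat M z \<phi>)" for e'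
    by simp
  show ?case
  proof
    assume "sat M e (foldr Ex (x # vs) \<phi>)"
    then obtain a z where "a \<in> universe M" "\<forall>v. v \<notin> set vs \<longrightarrow> z v = (e(x := a)) v"
      "\<forall>v\<in>set vs. z v \<in> universe M" "sat M z \<phi>"
      using IH by auto
    then show "\<exists>z. (\<forall>v. v \<notin> set (x # vs) \<longrightarrow> z v = e v) \<and>
      (\<forall>v\<in>set (x # vs). z v \<in> universe M) \<and> sat M z \<phi>"
      using Cons.prems by (intro exI[of _ z]) auto
  next
    assume "\<exists>z. (\<forall>v. v \<notin> set (x # vs) \<longrightarrow> z v = e v) \<and>
      (\<forall>v\<in>set (x # vs). z v \<in> universe M) \<and> sat M z \<phi>"
    then obtain z where z: "\<forall>v. v \<notin> set (x # vs) \<longrightarrow> z v = e v"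
      "\<forall>v\<in>set (x # vs). z v \<in> universe M" "sat M z \<phi>" by blast
    then have "sat M (e(x := z x)) (foldr Ex vs \<phi>)"
      unfolding IH by (intro exI[of _ z]) auto
    then show "sat M e (foldr Ex (x # vs) \<phi>)" using z by auto
  qed
qed

lemma gadget_formula:
  "\<exists>\<xi>. binary_fm \<rho> r \<xi> \<and> (\<forall>M a b. a \<in> universe M \<longrightarrow> b \<in> universe M \<longrightarrow>
     (models2 M \<xi> a b \<longleftrightarrow> (\<exists>z. z 0 = a \<and> z 1 = b \<and> gadget 0 M z)))"
proof -
  obtain ts where ts: "set ts = gadget_tuples 0"
    using finite_list[OF finite_gadget_tuples] by blast
  define \<psi> where "\<psi> = foldr Conj (map (Rel 1) ts) (Eq 0 0)"
  define \<xi> where "\<xi> = foldr Ex [2..<gadget_size] \<psi>"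
  have "set xs \<subseteq> {..<gadget_size}" "length xs = r 1" if "xs \<in> gadget_tuples 0" for xs
    using that by (fastforce simp: gadget_tuples_def)+
  then have "fv \<psi> \<subseteq> {..<gadget_size}" "is_fm \<rho> r \<psi>"
    using ts two_le_gadget_size rho_pos by (auto simp: \<psi>_def fv_foldr_Conj is_fm_foldr_Conj)
  moreover from this(1) have "fv \<psi> - {2..<gadget_size} \<subseteq> {0, 1}" by auto
  ultimately have "binary_fm \<rho> r \<xi>"
    by (simp add: \<xi>_def binary_fm_def fv_foldr_Ex is_fm_foldr_Ex)
  moreover have "models2 M \<xi> a b \<longleftrightarrow> (\<exists>z. z 0 = a \<and> z 1 = b \<and> gadget 0 M z)"
    if ab: "a \<in> universe M" "b \<in> universe M" for M :: "nat rel_struct" and a b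
  proof -
    have \<psi>: "sat M z \<psi> \<longleftrightarrow> (\<forall>xs\<in>gadget_tuples 0. map z xs \<in> rel M 1)" for z
      by (auto simp: \<psi>_def sat_foldr_Conj ts)
    have "models2 M \<xi> a b \<longleftrightarrow> (\<exists>z. (\<forall>v. v \<notin> {2..<gadget_size} \<longrightarrow> z v = (if v = 0 then a else b)) \<and>
      (\<forall>v\<in>{2..<gadget_size}. z v \<in> universe M) \<and> sat M z \<psi>)"
      by (simp add: models2_def \<xi>_def sat_foldr_Ex)
    also have "\<dots> \<longleftrightarrow> (\<exists>z. z 0 = a \<and> z 1 = b \<and> gadget 0 M z)"
    proof
      assume "\<exists>z. (\<forall>v. v \<notin> {2..<gadget_size} \<longrightarrow> z v = (if v = 0 then a else b)) \<and>
        (\<forall>v\<in>{2..<gadget_size}. z v \<in> universe M) \<and> sat M z \<psi>"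
      then obtain z where z: "\<forall>v. v \<notin> {2..<gadget_size} \<longrightarrow> z v = (if v = 0 then a else b)"
        "\<forall>v\<in>{2..<gadget_size}. z v \<in> universe M" "sat M z \<psi>" by blast
      have "z v \<in> universe M" if "v < gadget_size" for v
        using z(1,2) ab that by (cases "v < 2") auto
      then show "\<exists>z. z 0 = a \<and> z 1 = b \<and> gadget 0 M z"
        using z(1,3) \<psi> by (intro exI[of _ z]) (auto simp: gadget_def)
    next
      assume "\<exists>z. z 0 = a \<and> z 1 = b \<and> gadget 0 M z"
      then obtain z where z: "z 0 = a" "z 1 = b" "gadget 0 M z" by blast
      \<comment> \<open>\<open>b\<close> is the value that \<open>models2\<close> gives to all
        variables other than \<open>0\<close>.\<close>
      let ?z = "\<lambda>v. if v < gadget_size then z v else b"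
      have eq: "map ?z xs = map z xs" if "xs \<in> gadget_tuples 0" for xs
        using \<open>\<And>xs. xs \<in> gadget_tuples 0 \<Longrightarrow> set xs \<subseteq> {..<gadget_size}\<close>[OF that] by auto
      have "sat M ?z \<psi>"
        unfolding \<psi>
      proof
        fix xs assume "xs \<in> gadget_tuples 0"
        then show "map ?z xs \<in> rel M 1"
          unfolding eq[OF \<open>xs \<in> gadget_tuples 0\<close>] using z(3) by (simp add: gadget_def)
      qed
      moreover have "?z v = (if v = 0 then a else b)" if "v \<notin> {2..<gadget_size}" for v
        using that z two_le_gadget_size by (cases "v = 0 \<or> v = 1") auto
      ultimately show "\<exists>z. (\<forall>v. v \<notin> {2..<gadget_size} \<longrightarrow> z v = (if v = 0 then a else b)) \<and>
        (\<forall>v\<in>{2..<gadget_size}. z v \<in> universe M) \<and> sat M z \<psi>"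
        using z(3) by (intro exI[of _ ?z]) (auto simp: gadget_def)
    qed
    finally show ?thesis .
  qed
  ultimately show ?thesis by blast
qed

text \<open>Any colouring is constant on the classes of \<open>\<gamma>\<close>, so it is determined
  by its values at one representative of each class, chosen by \<open>inv_into\<close>.\<close>

lemma card_colourings_of_structure_le:
  assumes M: "in_class n M" "extension m M \<gamma>" "gadget_size \<le> m" "colouring \<rho> l M \<gamma>"
  shows "card {\<gamma>' \<in> colourings n. colouring \<rho> l M \<gamma>'} \<le> l ^ l"
proof -
  have U: "universe M = {1..n}" using M(1) by (simp add: in_class_def)
  let ?s = "inv_into {1..n} \<gamma>"
  let ?\<Gamma> = "{\<gamma>' \<in> colourings n. colouring \<rho> l M \<gamma>'}"
  let ?F = "\<gamma> ` {1..n} \<rightarrow>\<^sub>E {1..l}"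
  have s: "?s (\<gamma> x) \<in> {1..n}" "\<gamma> (?s (\<gamma> x)) = \<gamma> x" if "x \<in> {1..n}" for x
    using inv_into_into[OF imageI[OF that], of \<gamma>] f_inv_into_f[OF imageI[OF that], of \<gamma>] by auto
  have "inj_on (\<lambda>\<gamma>'. restrict (\<gamma>' \<circ> ?s) (\<gamma> ` {1..n})) ?\<Gamma>"
  proof (rule inj_onI)
    fix \<alpha> \<beta> assume \<alpha>: "\<alpha> \<in> ?\<Gamma>" and \<beta>: "\<beta> \<in> ?\<Gamma>"
      and eq: "restrict (\<alpha> \<circ> ?s) (\<gamma> ` {1..n}) = restrict (\<beta> \<circ> ?s) (\<gamma> ` {1..n})"
    have "\<alpha> x = \<beta> x" if x: "x \<in> {1..n}" for x
    proof -
      have "\<alpha> (?s (\<gamma> x)) = \<alpha> x" "\<beta> (?s (\<gamma> x)) = \<beta> x"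
        using extension_unique_colouring[OF M _ s(1)[OF x] x] s(2)[OF x] \<alpha> \<beta> by auto
      moreover have "\<alpha> (?s (\<gamma> x)) = \<beta> (?s (\<gamma> x))"
        using fun_cong[OF eq, of "\<gamma> x"] x by simp
      ultimately show ?thesis by simp
    qed
    then show "\<alpha> = \<beta>"
      using \<alpha> \<beta> unfolding colourings_def by (intro PiE_ext[of \<alpha> "{1..n}" _ \<beta>]) auto
  qed
  moreover have "(\<lambda>\<gamma>'. restrict (\<gamma>' \<circ> ?s) (\<gamma> ` {1..n})) ` ?\<Gamma> \<subseteq> ?F"
  proof
    fix f assume "f \<in> (\<lambda>\<gamma>'. restrict (\<gamma>' \<circ> ?s) (\<gamma> ` {1..n})) ` ?\<Gamma>"
    then obtain \<gamma>' where \<gamma>': "\<gamma>' \<in> colourings n" "f = restrict (\<gamma>' \<circ> ?s) (\<gamma> ` {1..n})" by blast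
    have "\<gamma>' (?s c) \<in> {1..l}" if "c \<in> \<gamma> ` {1..n}" for c
      using inv_into_into[OF that] \<gamma>'(1) unfolding colourings_def by blast
    then show "f \<in> ?F" unfolding \<gamma>'(2) by auto
  qed
  moreover have "finite ?F" by (intro finite_PiE) auto
  ultimately have "card ?\<Gamma> \<le> card ?F" by (rule card_inj_on_le)
  also have "\<dots> = l ^ card (\<gamma> ` {1..n})" by (simp add: card_funcsetE)
  also have "\<dots> \<le> l ^ l"
  proof -
    have "\<gamma> ` {1..n} \<subseteq> {1..l}" using M(4) U by (auto simp: colouring_def)
    then have "card (\<gamma> ` {1..n}) \<le> l" using card_mono[of "{1..l}"] by fastforce
    then show ?thesis using two_le_l by (intro power_increasing) auto
  qed
  finally show ?thesis .
qed

section \<open>Back and forth\<close>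

text \<open>The finite map in question sends \<open>e x\<close> to \<open>e' x\<close>. Giving it by
  two assignments to variables matches \<open>sat\<close>; the second clause makes it well defined
  and injective.\<close>

definition partial_iso ::
    "nat rel_struct \<Rightarrow> (nat \<Rightarrow> nat) \<Rightarrow> nat rel_struct \<Rightarrow> (nat \<Rightarrow> nat) \<Rightarrow> nat set \<Rightarrow> (nat \<Rightarrow> nat) \<Rightarrow> (nat \<Rightarrow> nat) \<Rightarrow> bool" where
  "partial_iso M \<gamma> M' \<gamma>' V e e' \<longleftrightarrow>
     (\<forall>x\<in>V. e x \<in> universe M \<and> e' x \<in> universe M' \<and> \<gamma> (e x) = \<gamma>' (e' x)) \<and>
     (\<forall>x\<in>V. \<forall>y\<in>V. e x = e y \<longleftrightarrow> e' x = e' y) \<and>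
     (\<forall>k xs. set xs \<subseteq> V \<longrightarrow> (map e xs \<in> rel M k \<longleftrightarrow> map e' xs \<in> rel M' k))"

lemma partial_iso_sym: "partial_iso M \<gamma> M' \<gamma>' V e e' \<Longrightarrow> partial_iso M' \<gamma>' M \<gamma> V e' e"
  by (auto simp: partial_iso_def)

lemma partial_iso_subset: "partial_iso M \<gamma> M' \<gamma>' V e e' \<Longrightarrow> W \<subseteq> V \<Longrightarrow> partial_iso M \<gamma> M' \<gamma>' W e e'"
  unfolding partial_iso_def by (meson subset_iff order_trans)

text \<open>Arity, distinctness and not being monochromatic depend only on the colours and on which
  entries coincide, so a tuple that holds in one structure is at least allowed in the other.\<close>

lemma partial_iso_transfer:
  assumes M: "in_class n M" "colouring \<rho> l M \<gamma>"
    and iso: "\<And>x. x \<in> V \<Longrightarrow> e' x \<in> {1..n'} \<and> \<gamma> (e x) = \<gamma>' (e' x)"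
      "\<And>x y. x \<in> V \<Longrightarrow> y \<in> V \<Longrightarrow> e x = e y \<longleftrightarrow> e' x = e' y"
    and xs: "set xs \<subseteq> V" "map e xs \<in> rel M k"
  shows "admissible {1..n'} k (map e' xs)" "\<not> monochromatic \<gamma>' (set (map e' xs))"
proof -
  have "admissible {1..n} k (map e xs)" using rel_admissible[OF M(1) xs(2)] .
  moreover have "inj_on e (set xs) \<longleftrightarrow> inj_on e' (set xs)"
    using iso(2) xs(1) unfolding inj_on_def by blast
  ultimately show "admissible {1..n'} k (map e' xs)"
    using iso(1) xs(1) by (auto simp: admissible_def distinct_map)
  have "monochromatic \<gamma>' (set (map e' xs)) \<longleftrightarrow> monochromatic \<gamma> (set (map e xs))"
    unfolding set_map monochromatic_image
    using iso(1) xs(1) by (intro monochromatic_cong) auto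
  then show "\<not> monochromatic \<gamma>' (set (map e' xs))"
    using colouring_not_monochromatic[OF M xs(2)] by simp
qed

lemma partial_iso_extend:
  assumes M: "in_class n M" "colouring \<rho> l M \<gamma>"
    and M': "in_class n' M'" "colouring \<rho> l M' \<gamma>'" "extension m M' \<gamma>'"
    and V: "finite V" "card V \<le> m" "x \<notin> V"
    and iso: "partial_iso M \<gamma> M' \<gamma>' V e e'"
    and a: "a \<in> universe M"
  shows "\<exists>a'\<in>universe M'. partial_iso M \<gamma> M' \<gamma>' (insert x V) (e(x := a)) (e'(x := a'))"
proof (cases "a \<in> e ` V")
  case True
  then obtain y where y: "y \<in> V" "a = e y" by blast
  \<comment> \<open>An element already named by \<open>y\<close> is answered by the value of
    \<open>y\<close>; renaming \<open>x\<close> to \<open>y\<close> reduces tuples to old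
    ones.\<close>
  have map_eq: "map (f(x := f y)) zs = map f (map (\<lambda>v. if v = x then y else v) zs)" for f :: "nat \<Rightarrow> nat" and zs
    by auto
  have "partial_iso M \<gamma> M' \<gamma>' (insert x V) (e(x := e y)) (e'(x := e' y))"
    unfolding partial_iso_def
  proof (intro conjI allI impI)
    fix k zs assume "set zs \<subseteq> insert x V"
    then have "set (map (\<lambda>v. if v = x then y else v) zs) \<subseteq> V" using y(1) by auto
    then show "map (e(x := e y)) zs \<in> rel M k \<longleftrightarrow> map (e'(x := e' y)) zs \<in> rel M' k"
      using iso unfolding map_eq partial_iso_def by blast
  qed (use iso y(1) V(3) in \<open>auto simp: partial_iso_def\<close>)
  then show ?thesis using y iso by (auto simp: partial_iso_def)
next
  case False
  have U: "universe M = {1..n}" "universe M' = {1..n'}"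
    using M(1) M'(1) by (simp_all add: in_class_def)
  \<comment> \<open>\<open>?g\<close> names the points of \<open>M'\<close>, with the placeholder
    for \<open>x\<close>; \<open>?Q\<close> records in these names which tuples hold in
    \<open>M\<close> once \<open>a\<close> is added.\<close>
  let ?E = "e(x := a)" and ?X = "e' ` V" and ?g = "e'(x := 0)"
  let ?Q = "{atom k (map ?g vs) | k vs. set vs \<subseteq> insert x V \<and> map ?E vs \<in> rel M k}"
  have X: "?X \<subseteq> {1..n'}" using iso U by (auto simp: partial_iso_def)
  moreover have "card ?X \<le> m" using card_image_le[OF V(1), of e'] V(2) by simp
  moreover have j: "\<gamma> a \<in> {1..l}" using M(2) a by (auto simp: colouring_def)
  ultimately obtain b where b: "b \<in> {1..n'} - ?X" "\<gamma>' b = \<gamma> a"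
    and ext: "\<And>k as. admissible (insert 0 ?X) k as \<Longrightarrow> 0 \<in> set as \<Longrightarrow>
      \<not> monochromatic (\<gamma>'(0 := \<gamma> a)) (set as) \<Longrightarrow> (map (id(0 := b)) as \<in> rel M' k \<longleftrightarrow> atom k as \<in> ?Q)"
    using extension_set[OF M'(1,3), of ?X "\<gamma> a" ?Q] by blast
  let ?E' = "e'(x := b)"
  have X0: "e' v \<noteq> 0" if "v \<in> V" for v using X that by fastforce
  have pts: "?E v \<in> {1..n} \<and> ?E' v \<in> {1..n'} \<and> \<gamma> (?E v) = \<gamma>' (?E' v)" if "v \<in> insert x V" for v
    using that iso U a b by (auto simp: partial_iso_def)
  have ker: "?E v = ?E w \<longleftrightarrow> ?E' v = ?E' w" if "v \<in> insert x V" "w \<in> insert x V" for v w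
    using that iso False b(1) V(3) by (auto simp: partial_iso_def)
  have ker_g: "?E v = ?E w \<longleftrightarrow> ?g v = ?g w" if "v \<in> insert x V" "w \<in> insert x V" for v w
    using that iso False V(3) X0[of v] X0[of w] by (auto simp: partial_iso_def)
  \<comment> \<open>\<open>h\<close> translates names back to points of \<open>M\<close>. It exists
    because \<open>?g\<close> and \<open>?E\<close> identify the same variables, \<open>0\<close>
    being outside the universe.\<close>
  obtain h where h: "\<And>v. v \<in> insert x V \<Longrightarrow> h (?g v) = ?E v"
  proof
    fix v assume v: "v \<in> insert x V"
    have "inv_into (insert x V) ?g (?g v) \<in> insert x V"
      "?g (inv_into (insert x V) ?g (?g v)) = ?g v"
      by (rule inv_into_into[OF imageI[OF v]], rule f_inv_into_f[OF imageI[OF v]])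
    then show "(?E \<circ> inv_into (insert x V) ?g) (?g v) = ?E v"
      using ker_g[OF _ v] by simp
  qed
  have "map ?E zs \<in> rel M k \<longleftrightarrow> map ?E' zs \<in> rel M' k" if zs: "set zs \<subseteq> insert x V" for zs k
  proof (cases "x \<in> set zs")
    case False
    then have eq: "map ?E zs = map e zs" "map ?E' zs = map e' zs" and "set zs \<subseteq> V" using zs by auto
    then show ?thesis using iso unfolding eq partial_iso_def by blast
  next
    case True
    have nz: "\<forall>v\<in>set zs. v = x \<or> e' v \<noteq> 0" using zs X0 by blast
    then have sub: "map (id(0 := b)) (map ?g zs) = map ?E' zs" by auto
    have new: "map ?E' zs \<in> rel M' k \<longleftrightarrow> atom k (map ?g zs) \<in> ?Q"
      if ad: "admissible {1..n'} k (map ?E' zs)" and nm: "\<not> monochromatic \<gamma>' (set (map ?E' zs))"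
    proof -
      have "inj_on ?E' (set zs) \<longleftrightarrow> inj_on ?g (set zs)"
        using ker ker_g zs unfolding inj_on_def by (meson subsetD)
      then have "admissible (insert 0 ?X) k (map ?g zs)"
        using ad zs by (auto simp: admissible_def distinct_map)
      moreover have "0 \<in> set (map ?g zs)" using True by force
      moreover have "monochromatic (\<gamma>'(0 := \<gamma> a)) (set (map ?g zs)) \<longleftrightarrow> monochromatic \<gamma>' (set (map ?E' zs))"
        unfolding set_map monochromatic_image
        using nz b(2) by (intro monochromatic_cong) auto
      ultimately show ?thesis using ext[of k "map ?g zs"] nm unfolding sub by simp
    qed
    show ?thesis
    proof
      assume rel: "map ?E zs \<in> rel M k"
      have "atom k (map ?g zs) \<in> ?Q" using rel zs by blast
      then show "map ?E' zs \<in> rel M' k"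
        using new partial_iso_transfer[OF M, of "insert x V" ?E' n' ?E \<gamma>' zs k] pts ker zs rel by blast
    next
      assume rel: "map ?E' zs \<in> rel M' k"
      have "atom k (map ?g zs) \<in> ?Q"
        using new rel rel_admissible[OF M'(1) rel] colouring_not_monochromatic[OF M'(1,2) rel] by blast
      \<comment> \<open>Only the atoms of \<open>zs\<close> and \<open>vs\<close> agree, not the
        tuples. Pushing the equation through \<open>h\<close> moves it to \<open>M\<close>, where
        atom and admissibility decide membership.\<close>
      then obtain vs where vs: "set vs \<subseteq> insert x V" "map ?E vs \<in> rel M k"
        "atom k (map ?g zs) = atom k (map ?g vs)"
        by (auto simp: atom_def)
      have comp: "map h (map ?g us) = map ?E us" if "set us \<subseteq> insert x V" for us
        unfolding map_map
      proof (rule map_cong[OF refl])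
        fix v assume "v \<in> set us"
        with that have "v \<in> insert x V" by blast
        from h[OF this] show "(h \<circ> ?g) v = ?E v" by (simp only: o_apply)
      qed
      have "atom k (map ?E zs) = atom k (map ?E vs)"
        using arg_cong[OF vs(3), of "map_atom h"]
        unfolding map_atom_atom comp[OF zs] comp[OF vs(1)] .
      moreover have "admissible {1..n} k (map ?E zs)"
        using partial_iso_transfer(1)[OF M'(1,2), of "insert x V" ?E n ?E' \<gamma> zs k] pts ker zs rel by metis
      moreover have "atom k (map ?E vs) \<in> diagram M"
        using vs(2) rel_iff_diagram[OF M(1)] by blast
      ultimately show "map ?E zs \<in> rel M k"
        using rel_iff_diagram[OF M(1)] by simp
    qed
  qed
  then have "partial_iso M \<gamma> M' \<gamma>' (insert x V) ?E ?E'"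
    unfolding partial_iso_def U using pts ker by blast
  with b(1) show ?thesis unfolding U by blast
qed

text \<open>At \<open>Ex\<close> the width bounds the number of points already placed, which the
  extension property must handle. Sums instead of maxima are wasteful but bound every subformula at
  once.\<close>

primrec width :: "fm \<Rightarrow> nat" where
  "width (Eq x y) = 0"
| "width (Rel k xs) = 0"
| "width (Neg \<phi>) = width \<phi>"
| "width (Conj \<phi> \<psi>) = width \<phi> + width \<psi>"
| "width (Ex x \<phi>) = card (fv \<phi> - {x}) + width \<phi>"

lemma finite_fv: "finite (fv \<phi>)"
  by (induction \<phi>) auto

lemma partial_iso_sat:
  assumes M: "in_class n M" "colouring \<rho> l M \<gamma>" "extension m M \<gamma>"
    and M': "in_class n' M'" "colouring \<rho> l M' \<gamma>'" "extension m M' \<gamma>'"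
    and "width \<phi> \<le> m" "partial_iso M \<gamma> M' \<gamma>' (fv \<phi>) e e'"
  shows "sat M e \<phi> \<longleftrightarrow> sat M' e' \<phi>"
  using assms(7,8)
proof (induction \<phi> arbitrary: e e')
  case (Conj \<phi> \<psi>)
  then have "partial_iso M \<gamma> M' \<gamma>' (fv \<phi>) e e'" "partial_iso M \<gamma> M' \<gamma>' (fv \<psi>) e e'"
    by (auto elim: partial_iso_subset)
  with Conj show ?case by simp
next
  case (Ex x \<phi>)
  let ?V = "fv \<phi> - {x}"
  have V: "finite ?V" "card ?V \<le> m" "x \<notin> ?V" using Ex.prems(1) finite_fv by auto
  have iso: "partial_iso M \<gamma> M' \<gamma>' ?V e e'" using Ex.prems(2) by simp
  have IH: "sat M (e(x := a)) \<phi> \<longleftrightarrow> sat M' (e'(x := a')) \<phi>"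
    if "partial_iso M \<gamma> M' \<gamma>' (insert x ?V) (e(x := a)) (e'(x := a'))" for a a'
  proof (rule Ex.IH)
    show "width \<phi> \<le> m" using Ex.prems(1) by simp
    show "partial_iso M \<gamma> M' \<gamma>' (fv \<phi>) (e(x := a)) (e'(x := a'))"
      by (rule partial_iso_subset[OF that]) auto
  qed
  show ?case
  proof
    assume "sat M e (Ex x \<phi>)"
    then obtain a where a: "a \<in> universe M" "sat M (e(x := a)) \<phi>" by auto
    obtain a' where "a' \<in> universe M'" "partial_iso M \<gamma> M' \<gamma>' (insert x ?V) (e(x := a)) (e'(x := a'))"
      using partial_iso_extend[OF M(1,2) M' V iso a(1)] by blast
    then show "sat M' e' (Ex x \<phi>)" using IH a(2) by auto
  next
    assume "sat M' e' (Ex x \<phi>)"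
    then obtain a' where a': "a' \<in> universe M'" "sat M' (e'(x := a')) \<phi>" by auto
    obtain a where "a \<in> universe M" "partial_iso M' \<gamma>' M \<gamma> (insert x ?V) (e'(x := a')) (e(x := a))"
      using partial_iso_extend[OF M'(1,2) M V partial_iso_sym[OF iso] a'(1)] by blast
    then show "sat M e (Ex x \<phi>)" using IH a'(2) by (auto dest: partial_iso_sym)
  qed
qed (auto simp: partial_iso_def)

text \<open>Without free variables any two assignments form a partial isomorphism, the empty tuple
  lying in no relation. Truth is thus independent of the assignment, and so \<open>Neg\<close>
  complements \<open>models\<close> although \<open>models\<close> quantifies universally over
  assignments.\<close>

lemma sentence_models_iff:
  assumes M: "in_class n M" "colouring \<rho> l M \<gamma>" "extension m M \<gamma>"
    and M': "in_class n' M'" "colouring \<rho> l M' \<gamma>'" "extension m M' \<gamma>'"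
    and \<phi>: "sentence \<rho> r \<phi>" "width \<phi> \<le> m"
  shows "models M \<phi> \<longleftrightarrow> models M' \<phi>"
    and "models M (Neg \<phi>) \<longleftrightarrow> \<not> models M \<phi>"
proof -
  have closed: "fv \<phi> = {}" using \<phi>(1) by (simp add: sentence_def)
  have rel_Nil: "[] \<notin> rel M k" if "in_class n M" for n M k
    using rel_admissible[OF that, of "[]" k] arity by (fastforce simp: admissible_def)
  have sat: "sat N e \<phi> \<longleftrightarrow> sat N' e' \<phi>"
    if "in_class k N" "colouring \<rho> l N \<delta>" "extension m N \<delta>"
      "in_class k' N'" "colouring \<rho> l N' \<delta>'" "extension m N' \<delta>'" for k N \<delta> k' N' \<delta>' e e'
    using that \<phi>(2) rel_Nil closed
    by (intro partial_iso_sat[OF that]) (auto simp: partial_iso_def)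
  have models: "models N \<phi> \<longleftrightarrow> (\<forall>e. sat N e \<phi>)" "models N (Neg \<phi>) \<longleftrightarrow> (\<forall>e. \<not> sat N e \<phi>)"
    if N: "in_class k N" "colouring \<rho> l N \<delta>" "extension m N \<delta>" for k N \<delta>
  proof -
    have "universe N \<noteq> {}" using N(1) unfolding in_class_def is_struct_def by blast
    then obtain a where "a \<in> universe N" by blast
    then have e0: "(\<lambda>_. a) \<in> UNIV \<rightarrow> universe N" by simp
    show "models N \<phi> \<longleftrightarrow> (\<forall>e. sat N e \<phi>)" "models N (Neg \<phi>) \<longleftrightarrow> (\<forall>e. \<not> sat N e \<phi>)"
      using e0 sat[OF N N, of "\<lambda>_. a"] by (auto simp: models_def)
  qed
  show "models M \<phi> \<longleftrightarrow> models M' \<phi>"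
    using sat[OF M M'] models[OF M] models[OF M'] by metis
  show "models M (Neg \<phi>) \<longleftrightarrow> \<not> models M \<phi>"
    using sat[OF M M] models[OF M] by metis
qed

section \<open>Almost all structures have a colouring with the extension property\<close>

definition extension_structure :: "nat \<Rightarrow> nat rel_struct \<Rightarrow> bool" where
  "extension_structure m M \<longleftrightarrow> (\<exists>n \<gamma>. in_class n M \<and> colouring \<rho> l M \<gamma> \<and> extension m M \<gamma>)"

text \<open>The first summand bounds the share of pairs with an unbalanced colouring, the second the
  share in which a balanced colouring lacks the extension property.\<close>

definition failure_rate :: "nat \<Rightarrow> nat \<Rightarrow> real" where
  "failure_rate m n = real l ^ n / 2 ^ ((n div (8 * l)) * (n div (8 * l))) +
     real ((n + 1) ^ m * l * 2 ^ (\<Sum>k=1..\<rho>. Suc m ^ r k)) *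
       (1 - 1 / 2 ^ (\<Sum>k=1..\<rho>. Suc m ^ r k)) ^ (n div (8 * l) - m)"

lemma sum_not_extension_le:
  assumes n: "n \<ge> 1" and R: "\<And>k. k \<in> {1..\<rho>} \<Longrightarrow> r k \<le> n div (8 * l)"
  shows "(\<Sum>\<gamma>\<in>colourings n. real (card {M \<in> coloured_by n \<gamma>. \<not> extension m M \<gamma>}))
    \<le> failure_rate m n * real (coloured_count n)"
proof -
  define q where "q = n div (8 * l)"
  define c where "c = (\<Sum>k=1..\<rho>. Suc m ^ r k)"
  define \<eta> where "\<eta> = real ((n + 1) ^ m * l * 2 ^ c) * (1 - 1 / 2 ^ c) ^ (q - m)"
  let ?U = "{\<gamma> \<in> colourings n. \<exists>i\<in>{1..l}. card (colour_class n \<gamma> i) < q}"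
  let ?bad = "\<lambda>\<gamma>. {M \<in> coloured_by n \<gamma>. \<not> extension m M \<gamma>}"
  have split: "(\<Sum>\<gamma>\<in>colourings n. real (card (?bad \<gamma>)))
      = (\<Sum>\<gamma>\<in>?U. real (card (?bad \<gamma>))) + (\<Sum>\<gamma>\<in>colourings n - ?U. real (card (?bad \<gamma>)))"
    using sum.subset_diff[of ?U "colourings n" "\<lambda>\<gamma>. real (card (?bad \<gamma>))"] finite_colourings
    by (simp add: add.commute)
  have "(\<Sum>\<gamma>\<in>?U. real (card (?bad \<gamma>))) \<le> (\<Sum>\<gamma>\<in>?U. 2 ^ card (free_atoms n \<gamma>))"
  proof (rule sum_mono)
    fix \<gamma> assume "\<gamma> \<in> ?U"
    then have \<gamma>: "\<gamma> \<in> colourings n" by simp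
    have "card (?bad \<gamma>) \<le> card (coloured_by n \<gamma>)"
      using finite_coloured_by[OF n \<gamma>] by (intro card_mono) auto
    then have "real (card (?bad \<gamma>)) \<le> real (2 ^ card (free_atoms n \<gamma>))"
      unfolding card_coloured_by[OF n \<gamma>] of_nat_le_iff .
    then show "real (card (?bad \<gamma>)) \<le> 2 ^ card (free_atoms n \<gamma>)" by simp
  qed
  also have "\<dots> \<le> (real l ^ n / 2 ^ (q * q)) * real (coloured_count n)"
    using sum_unbalanced_le[OF q_def] R by (simp add: q_def)
  finally have unbalanced: "(\<Sum>\<gamma>\<in>?U. real (card (?bad \<gamma>)))
      \<le> (real l ^ n / 2 ^ (q * q)) * real (coloured_count n)" .
  have "(\<Sum>\<gamma>\<in>colourings n - ?U. real (card (?bad \<gamma>)))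
      \<le> (\<Sum>\<gamma>\<in>colourings n - ?U. \<eta> * 2 ^ card (free_atoms n \<gamma>))"
  proof (rule sum_mono)
    fix \<gamma> assume "\<gamma> \<in> colourings n - ?U"
    then show "real (card (?bad \<gamma>)) \<le> \<eta> * 2 ^ card (free_atoms n \<gamma>)"
      unfolding \<eta>_def by (intro card_not_extension_le[OF n _ _ c_def]) (auto simp: not_less)
  qed
  also have "\<dots> \<le> (\<Sum>\<gamma>\<in>colourings n. \<eta> * 2 ^ card (free_atoms n \<gamma>))"
    using finite_colourings by (intro sum_mono2) (auto simp: \<eta>_def)
  also have "\<dots> = \<eta> * real (coloured_count n)"
    by (simp add: coloured_count_def sum_distrib_left)
  finally have balanced: "(\<Sum>\<gamma>\<in>colourings n - ?U. real (card (?bad \<gamma>))) \<le> \<eta> * real (coloured_count n)" .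
  have "failure_rate m n = real l ^ n / 2 ^ (q * q) + \<eta>"
    by (simp add: failure_rate_def \<eta>_def q_def c_def)
  then show ?thesis
    using split unbalanced balanced by (simp add: distrib_right)
qed

text \<open>Let there be \<open>W\<close> pairs and let \<open>\<epsilon>\<close> be the failure
  rate. Every bad structure yields a bad pair, so there are at most \<open>\<epsilon> * W\<close>;
  the good pairs number at least \<open>(1 - \<epsilon>) * W\<close> and at most
  \<open>l ^ l\<close> per structure. Eliminating \<open>W\<close> gives the bound, kept free of
  division since \<open>\<epsilon>\<close> may exceed \<open>1\<close>.\<close>

lemma card_not_extension_structure_le:
  assumes n: "n \<ge> 1" and R: "\<And>k. k \<in> {1..\<rho>} \<Longrightarrow> r k \<le> n div (8 * l)"
    and m: "gadget_size \<le> m"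
  shows "real (card {M \<in> C \<rho> r l I n. \<not> extension_structure m M}) * (1 - failure_rate m n)
    \<le> failure_rate m n * real (l ^ l) * real (card (C \<rho> r l I n))"
proof -
  let ?K = "C \<rho> r l I n" and ?W = "real (coloured_count n)" and ?\<epsilon> = "failure_rate m n"
  let ?bad = "\<lambda>\<gamma>. {M \<in> coloured_by n \<gamma>. \<not> extension m M \<gamma>}"
  let ?good = "\<lambda>\<gamma>. {M \<in> coloured_by n \<gamma>. extension m M \<gamma>}"
  let ?B = "(\<Sum>\<gamma>\<in>colourings n. real (card (?bad \<gamma>)))"
  let ?G = "(\<Sum>\<gamma>\<in>colourings n. real (card (?good \<gamma>)))"
  have B: "?B \<le> ?\<epsilon> * ?W" using sum_not_extension_le[OF n R] by blast
  have "real (card (?bad \<gamma>)) + real (card (?good \<gamma>)) = 2 ^ card (free_atoms n \<gamma>)"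
    if "\<gamma> \<in> colourings n" for \<gamma>
  proof -
    have "coloured_by n \<gamma> = ?bad \<gamma> \<union> ?good \<gamma>" "?bad \<gamma> \<inter> ?good \<gamma> = {}" by auto
    then have "card (coloured_by n \<gamma>) = card (?bad \<gamma>) + card (?good \<gamma>)"
      using finite_coloured_by[OF n that] by (metis (no_types, lifting) card_Un_disjoint finite_Un)
    then show ?thesis using card_coloured_by[OF n that] by (simp flip: of_nat_add)
  qed
  then have BG: "?B + ?G = ?W"
    by (simp add: coloured_count_def flip: sum.distrib)
  have G: "?G \<le> real (l ^ l) * real (card ?K)"
  proof -
    let ?ext = "{M \<in> ?K. extension_structure m M}"
    have finK: "finite ?K" using finite_C[OF n] .
    have "(\<Sum>\<gamma>\<in>colourings n. card (?good \<gamma>)) = card (Sigma (colourings n) ?good)"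
      using finite_colourings finite_coloured_by[OF n] by (simp add: card_SigmaI)
    also have "\<dots> \<le> card (Sigma ?K (\<lambda>M. {\<gamma> \<in> colourings n. colouring \<rho> l M \<gamma> \<and> extension m M \<gamma>}))"
    proof (rule card_inj_on_le[of prod.swap])
      show "finite (Sigma ?K (\<lambda>M. {\<gamma> \<in> colourings n. colouring \<rho> l M \<gamma> \<and> extension m M \<gamma>}))"
        using finK finite_colourings by auto
    qed (auto simp: coloured_by_def C_eq)
    also have "\<dots> = (\<Sum>M\<in>?K. card {\<gamma> \<in> colourings n. colouring \<rho> l M \<gamma> \<and> extension m M \<gamma>})"
      using finK finite_colourings by (simp add: card_SigmaI)
    also have "\<dots> \<le> (\<Sum>M\<in>?K. l ^ l)"
    proof (rule sum_mono)
      fix M assume "M \<in> ?K"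
      then have M: "in_class n M" by (auto simp: C_eq coloured_by_def)
      let ?\<Gamma> = "{\<gamma> \<in> colourings n. colouring \<rho> l M \<gamma> \<and> extension m M \<gamma>}"
      show "card ?\<Gamma> \<le> l ^ l"
      proof (cases "?\<Gamma> = {}")
        case True
        then show ?thesis unfolding True by simp
      next
        case False
        then obtain \<gamma> where "colouring \<rho> l M \<gamma>" "extension m M \<gamma>" by blast
        then have "card {\<gamma>' \<in> colourings n. colouring \<rho> l M \<gamma>'} \<le> l ^ l"
          using card_colourings_of_structure_le[OF M _ m] by blast
        moreover have "card ?\<Gamma> \<le> card {\<gamma>' \<in> colourings n. colouring \<rho> l M \<gamma>'}"
          using finite_colourings by (intro card_mono) auto
        ultimately show ?thesis by simp
      qed
    qed
    finally have "(\<Sum>\<gamma>\<in>colourings n. card (?good \<gamma>)) \<le> card ?K * l ^ l" by simp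
    then have "real (\<Sum>\<gamma>\<in>colourings n. card (?good \<gamma>)) \<le> real (card ?K * l ^ l)"
      unfolding of_nat_le_iff .
    then show ?thesis by (simp add: mult.commute)
  qed
  have bad: "real (card {M \<in> ?K. \<not> extension_structure m M}) \<le> ?B"
  proof -
    have "{M \<in> ?K. \<not> extension_structure m M} \<subseteq> (\<Union>\<gamma>\<in>colourings n. ?bad \<gamma>)"
      by (auto simp: C_eq coloured_by_def extension_structure_def)
    then have "card {M \<in> ?K. \<not> extension_structure m M} \<le> card (\<Union>\<gamma>\<in>colourings n. ?bad \<gamma>)"
      using finite_colourings finite_coloured_by[OF n] by (intro card_mono) auto
    also have "\<dots> \<le> (\<Sum>\<gamma>\<in>colourings n. card (?bad \<gamma>))"
      using finite_colourings by (rule card_UN_le)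
    finally show ?thesis by (simp flip: of_nat_sum)
  qed
  have "0 \<le> ?\<epsilon>" by (simp add: failure_rate_def)
  show ?thesis
  proof (cases "?\<epsilon> \<le> 1")
    case True
    have "real (card {M \<in> ?K. \<not> extension_structure m M}) * (1 - ?\<epsilon>) \<le> ?\<epsilon> * ?W * (1 - ?\<epsilon>)"
      using bad B True by (intro mult_right_mono) auto
    also have "\<dots> = ?\<epsilon> * ((1 - ?\<epsilon>) * ?W)" by simp
    also have "\<dots> \<le> ?\<epsilon> * ?G"
      using B BG \<open>0 \<le> ?\<epsilon>\<close> by (intro mult_left_mono) (auto simp: algebra_simps)
    also have "\<dots> \<le> ?\<epsilon> * (real (l ^ l) * real (card ?K))"
      using G \<open>0 \<le> ?\<epsilon>\<close> by (rule mult_left_mono)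
    finally show ?thesis by (simp add: mult_ac)
  next
    case False
    then have "real (card {M \<in> ?K. \<not> extension_structure m M}) * (1 - ?\<epsilon>) \<le> 0"
      by (intro mult_nonneg_nonpos) auto
    also have "0 \<le> ?\<epsilon> * real (l ^ l) * real (card ?K)" using \<open>0 \<le> ?\<epsilon>\<close> by simp
    finally show ?thesis .
  qed
qed

section \<open>Decay of the failure rate\<close>

lemma failure_rate_tendsto_0: "failure_rate m \<longlonglongrightarrow> 0"
proof -
  define c where "c = (\<Sum>k=1..\<rho>. Suc m ^ r k)"
  define a :: real where "a = 1 - 1 / 2 ^ c"
  define D where "D = 8 * l"
  define q where "q n = n div D" for n
  have "D > 0" using two_le_l by (simp add: D_def)
  have q_at_top: "filterlim q at_top sequentially"
    unfolding q_def by (rule filterlim_at_top_div_const_nat[OF \<open>D > 0\<close>])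
  have n_less: "n < D * Suc (q n)" for n
    using dividend_less_times_div[OF \<open>D > 0\<close>, of n] by (simp add: q_def)
  have "c \<ge> 1"
    unfolding c_def using rho_pos member_le_sum[of 1 "{1..\<rho>}" "\<lambda>k. Suc m ^ r k"]
    by (metis One_nat_def le_trans one_in_vocabulary finite_atLeastAtMost one_le_power le_add1 plus_1_eq_Suc zero_le)
  then have "(2::real) ^ 1 \<le> 2 ^ c" by (intro power_increasing) auto
  then have a: "0 < a" "a < 1" by (auto simp: a_def field_simps)
  have "(\<lambda>n. real l ^ n / 2 ^ (q n * q n)) \<longlonglongrightarrow> 0"
  proof (rule tendsto_sandwich[where f = "\<lambda>_. 0"])
    show "\<forall>\<^sub>F n in sequentially. real l ^ n / 2 ^ (q n * q n) \<le> (1 / 2) ^ q n"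
      using eventually_compose_filterlim[OF eventually_ge_at_top[of "2 * (l * D) + 1"] q_at_top]
    proof eventually_elim
      case (elim n)
      \<comment> \<open>With \<open>l \<le> 2 ^ l\<close> and \<open>n < D * Suc (q n)\<close> the
        numerator has an exponent linear in \<open>q n\<close>; from
        \<open>q n \<ge> 2 * (l * D) + 1\<close> on, the square exceeds it by at least
        \<open>q n\<close>.\<close>
      have "real l ^ n \<le> (2 ^ l) ^ n" by (intro power_mono) (simp_all add: less_imp_le)
      also have "\<dots> \<le> 2 ^ (l * (D * Suc (q n)))"
        unfolding power_mult[symmetric] using n_less[of n] by (intro power_increasing mult_le_mono2) auto
      also have "\<dots> * 2 ^ q n \<le> (2::real) ^ (q n * q n)"
      proof -
        have "l * (D * Suc (q n)) + q n = l * D * q n + l * D + q n" by (simp add: algebra_simps)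
        also have "\<dots> \<le> l * D * q n + l * D * q n + q n" using elim by (simp add: add_mono)
        also have "\<dots> = (2 * (l * D) + 1) * q n" by (simp add: algebra_simps)
        also have "\<dots> \<le> q n * q n" using elim by (rule mult_le_mono1)
        finally show ?thesis unfolding power_add[symmetric] by (intro power_increasing) auto
      qed
      finally show ?case by (simp add: field_simps)
    qed
    show "(\<lambda>n. (1 / 2 :: real) ^ q n) \<longlonglongrightarrow> 0"
      by (rule filterlim_compose[OF _ q_at_top]) (simp add: LIMSEQ_power_zero)
  qed auto
  moreover have "(\<lambda>n. real ((n + 1) ^ m * l * 2 ^ c) * a ^ (q n - m)) \<longlonglongrightarrow> 0"
  proof (rule tendsto_sandwich[where f = "\<lambda>_. 0"])
    \<comment> \<open>In terms of \<open>p = q n - m\<close> the bound is a polynomial times a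
      geometric sequence, since \<open>n + 1 \<le> D * (p + m + 1)\<close> once
      \<open>q n \<ge> m\<close>.\<close>
    let ?g = "\<lambda>p. real (l * 2 ^ c) * real D ^ m * (real (p + m + 1) ^ m * a ^ p)"
    show "\<forall>\<^sub>F n in sequentially. real ((n + 1) ^ m * l * 2 ^ c) * a ^ (q n - m) \<le> ?g (q n - m)"
      using eventually_compose_filterlim[OF eventually_ge_at_top[of m] q_at_top]
    proof eventually_elim
      case (elim n)
      have "real (n + 1) \<le> real (D * Suc (q n))" using n_less[of n] by (simp only: of_nat_le_iff)
      then have "real (n + 1) ^ m \<le> (real D * real (q n - m + m + 1)) ^ m"
        using elim by (intro power_mono) (auto simp: distrib_left)
      then have "real (n + 1) ^ m * (real (l * 2 ^ c) * a ^ (q n - m))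
          \<le> (real D * real (q n - m + m + 1)) ^ m * (real (l * 2 ^ c) * a ^ (q n - m))"
        using a by (intro mult_right_mono) auto
      then show ?case by (simp add: power_mult_distrib mult_ac)
    qed
    have "(\<lambda>p. real (p + m + 1) ^ m * a ^ p) \<longlonglongrightarrow> 0"
      using a by real_asymp
    then have "?g \<longlonglongrightarrow> 0" using tendsto_mult_right_zero by blast
    moreover have "filterlim (\<lambda>n. q n - m) at_top sequentially"
      by (rule filterlim_compose[OF filterlim_minus_const_nat_at_top q_at_top])
    ultimately show "(\<lambda>n. ?g (q n - m)) \<longlonglongrightarrow> 0" by (rule filterlim_compose)
  qed (use a in auto)
  ultimately have "(\<lambda>n. real l ^ n / 2 ^ (q n * q n) + real ((n + 1) ^ m * l * 2 ^ c) * a ^ (q n - m)) \<longlonglongrightarrow> 0 + 0"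
    by (rule tendsto_add)
  moreover have "failure_rate m = (\<lambda>n. real l ^ n / 2 ^ (q n * q n) + real ((n + 1) ^ m * l * 2 ^ c) * a ^ (q n - m))"
    by (auto simp: failure_rate_def q_def a_def c_def D_def fun_eq_iff)
  ultimately show ?thesis by simp
qed

lemma card_C_pos:
  assumes "n \<ge> 1"
  shows "card (C \<rho> r l I n) > 0"
proof -
  have "card (colourings n) > 0" using two_le_l by (simp add: card_colourings)
  then obtain \<gamma> where \<gamma>: "\<gamma> \<in> colourings n" by (auto simp: card_gt_0_iff)
  then have "coloured_by n \<gamma> \<noteq> {}" using card_coloured_by[OF assms \<gamma>] by auto
  with \<gamma> show ?thesis using finite_C[OF assms] by (auto simp: card_gt_0_iff C_eq)
qed

text \<open>The passage from counting to \<open>almost_all\<close>: once the failure rate is below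
  \<open>1 / 2\<close>, structures without the extension property make up at most
  \<open>2 * l ^ l\<close> times that rate.\<close>

lemma almost_all_if_extension_structure:
  assumes m: "gadget_size \<le> m"
    and P: "\<And>n M. M \<in> C \<rho> r l I n \<Longrightarrow> extension_structure m M \<Longrightarrow> P M"
  shows "almost_all (C \<rho> r l I) P"
proof -
  let ?K = "C \<rho> r l I" and ?\<epsilon> = "failure_rate m"
  have lower: "1 - 2 * real (l ^ l) * ?\<epsilon> n \<le> real (card {M \<in> ?K n. P M}) / real (card (?K n))"
    and upper: "real (card {M \<in> ?K n. P M}) / real (card (?K n)) \<le> 1"
    if n: "n \<ge> 1" "\<And>k. k \<in> {1..\<rho>} \<Longrightarrow> r k \<le> n div (8 * l)" "?\<epsilon> n < 1 / 2" for n
  proof -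
    let ?b = "real (card {M \<in> ?K n. \<not> extension_structure m M})"
    have K: "real (card (?K n)) > 0" using card_C_pos[OF n(1)] by simp
    have fin: "finite (?K n)" using finite_C[OF n(1)] .
    have "?b * (1 / 2) \<le> ?b * (1 - ?\<epsilon> n)"
      using n(3) by (intro mult_left_mono) auto
    also have "\<dots> \<le> ?\<epsilon> n * real (l ^ l) * real (card (?K n))"
      using card_not_extension_structure_le[OF n(1,2) m] .
    finally have b: "?b \<le> 2 * real (l ^ l) * ?\<epsilon> n * real (card (?K n))" by (simp add: mult_ac)
    have "?K n \<subseteq> {M \<in> ?K n. P M} \<union> {M \<in> ?K n. \<not> extension_structure m M}" using P by blast
    then have "card (?K n) \<le> card ({M \<in> ?K n. P M} \<union> {M \<in> ?K n. \<not> extension_structure m M})"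
      using fin by (intro card_mono) auto
    also have "\<dots> \<le> card {M \<in> ?K n. P M} + card {M \<in> ?K n. \<not> extension_structure m M}"
      by (rule card_Un_le)
    finally have "real (card (?K n)) \<le> real (card {M \<in> ?K n. P M}) + ?b"
      by (simp only: of_nat_le_iff flip: of_nat_add)
    with b have "(1 - 2 * real (l ^ l) * ?\<epsilon> n) * real (card (?K n)) \<le> real (card {M \<in> ?K n. P M})"
      by (simp add: left_diff_distrib)
    then show "1 - 2 * real (l ^ l) * ?\<epsilon> n \<le> real (card {M \<in> ?K n. P M}) / real (card (?K n))"
      using K by (simp add: pos_le_divide_eq)
    have "card {M \<in> ?K n. P M} \<le> card (?K n)" using fin by (intro card_mono) auto
    then show "real (card {M \<in> ?K n. P M}) / real (card (?K n)) \<le> 1"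
      using K by simp
  qed
  have "8 * l > 0" using two_le_l by simp
  then have q_at_top: "filterlim (\<lambda>n. n div (8 * l)) at_top sequentially"
    by (rule filterlim_at_top_div_const_nat)
  have large: "\<forall>\<^sub>F n in sequentially. n \<ge> 1 \<and> (\<forall>k\<in>{1..\<rho>}. r k \<le> n div (8 * l)) \<and> ?\<epsilon> n < 1 / 2"
  proof (intro eventually_conj eventually_ball_finite)
    show "\<forall>\<^sub>F n in sequentially. ?\<epsilon> n < 1 / 2"
      using order_tendstoD(2)[OF failure_rate_tendsto_0, of "1 / 2"] by simp
    show "\<forall>k\<in>{1..\<rho>}. \<forall>\<^sub>F n in sequentially. r k \<le> n div (8 * l)"
      using q_at_top by (auto simp: filterlim_at_top)
  qed (auto intro: eventually_ge_at_top)
  show ?thesis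
    unfolding almost_all_def
  proof (rule tendsto_sandwich)
    have "(\<lambda>n. 1 - 2 * real (l ^ l) * ?\<epsilon> n) \<longlonglongrightarrow> 1 - 2 * real (l ^ l) * 0"
      by (intro tendsto_intros failure_rate_tendsto_0)
    then show "(\<lambda>n. 1 - 2 * real (l ^ l) * ?\<epsilon> n) \<longlonglongrightarrow> 1" by simp
    show "\<forall>\<^sub>F n in sequentially. 1 - 2 * real (l ^ l) * ?\<epsilon> n \<le> real (card {M \<in> ?K n. P M}) / real (card (?K n))"
      using large by eventually_elim (rule lower, auto)
    show "\<forall>\<^sub>F n in sequentially. real (card {M \<in> ?K n. P M}) / real (card (?K n)) \<le> 1"
      using large by eventually_elim (rule upper, auto)
  qed simp
qed

section \<open>From the extension property to the three claims\<close>

lemma extension_structureE: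
  assumes "extension_structure m M"
  obtains n \<gamma> where "universe M = {1..n}" "in_class n M" "colouring \<rho> l M \<gamma>" "extension m M \<gamma>"
  using assms by (auto simp: extension_structure_def in_class_def)

text \<open>Extension structures of all sizes agree on a sentence of width at most \<open>m\<close>:
  a single one satisfying it decides for the sentence, and if there is none, all satisfy the
  negation. The maximum with \<open>gadget_size\<close> is what the counting needs.\<close>

lemma zero_one_law_C: "zero_one_law \<rho> r (C \<rho> r l I)"
  unfolding zero_one_law_def
proof (intro allI impI)
  fix \<phi> assume \<phi>: "sentence \<rho> r \<phi>"
  define m where "m = max gadget_size (width \<phi>)"
  have m: "gadget_size \<le> m" "width \<phi> \<le> m" by (auto simp: m_def)
  show "almost_all (C \<rho> r l I) (\<lambda>M. models M \<phi>) \<or> almost_all (C \<rho> r l I) (\<lambda>M. models M (Neg \<phi>))"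
  proof (cases "\<exists>M. extension_structure m M \<and> models M \<phi>")
    case True
    then obtain M where M: "extension_structure m M" "models M \<phi>" by blast
    have "almost_all (C \<rho> r l I) (\<lambda>M. models M \<phi>)"
    proof (rule almost_all_if_extension_structure[OF m(1)])
      fix M' :: "nat rel_struct" assume "extension_structure m M'"
      with M(1) have "models M \<phi> \<longleftrightarrow> models M' \<phi>"
        using sentence_models_iff(1)[OF _ _ _ _ _ _ \<phi> m(2)] by (meson extension_structure_def)
      with M(2) show "models M' \<phi>" by simp
    qed
    then show ?thesis ..
  next
    case False
    have "almost_all (C \<rho> r l I) (\<lambda>M. models M (Neg \<phi>))"
    proof (rule almost_all_if_extension_structure[OF m(1)])
      fix M :: "nat rel_struct" assume M: "extension_structure m M"
      then have "models M (Neg \<phi>) \<longleftrightarrow> \<not> models M \<phi>"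
        using sentence_models_iff(2)[OF _ _ _ _ _ _ \<phi> m(2)] by (meson extension_structure_def)
      with M False show "models M (Neg \<phi>)" by blast
    qed
    then show ?thesis ..
  qed
qed

lemma almost_all_colouring_definable:
  "\<exists>\<xi>. binary_fm \<rho> r \<xi> \<and> almost_all (C \<rho> r l I)
     (\<lambda>M. \<forall>\<gamma>. colouring \<rho> l M \<gamma> \<longrightarrow>
        (\<forall>a\<in>universe M. \<forall>b\<in>universe M. \<gamma> a = \<gamma> b \<longleftrightarrow> models2 M \<xi> a b))"
proof -
  obtain \<xi> where \<xi>: "binary_fm \<rho> r \<xi>"
    and sat_\<xi>: "\<And>M a b. a \<in> universe M \<Longrightarrow> b \<in> universe M \<Longrightarrow>
      models2 M \<xi> a b \<longleftrightarrow> (\<exists>z. z 0 = a \<and> z 1 = b \<and> gadget 0 M z)"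
    using gadget_formula by blast
  have "almost_all (C \<rho> r l I) (\<lambda>M. \<forall>\<gamma>. colouring \<rho> l M \<gamma> \<longrightarrow>
        (\<forall>a\<in>universe M. \<forall>b\<in>universe M. \<gamma> a = \<gamma> b \<longleftrightarrow> models2 M \<xi> a b))"
  proof (rule almost_all_if_extension_structure[OF order_refl], intro allI impI ballI)
    fix M \<gamma> a b
    assume ext: "extension_structure gadget_size M" and \<gamma>: "colouring \<rho> l M \<gamma>"
      and ab: "a \<in> universe M" "b \<in> universe M"
    from ext obtain n \<gamma>\<^sub>0 where U: "universe M = {1..n}"
      and M: "in_class n M" "colouring \<rho> l M \<gamma>\<^sub>0" "extension gadget_size M \<gamma>\<^sub>0"
      by (rule extension_structureE)
    have "\<gamma> a = \<gamma> b \<longleftrightarrow> \<gamma>\<^sub>0 a = \<gamma>\<^sub>0 b"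
      using extension_unique_colouring[OF M(1,3) order_refl M(2) \<gamma>] ab U by simp
    also have "\<dots> \<longleftrightarrow> models2 M \<xi> a b"
      using extension_gadget_iff[OF M(1,3) order_refl M(2)] sat_\<xi>[OF ab] ab U by simp
    finally show "\<gamma> a = \<gamma> b \<longleftrightarrow> models2 M \<xi> a b" .
  qed
  with \<xi> show ?thesis by blast
qed

lemma almost_all_uniquely_colourable: "almost_all (C \<rho> r l I) (uniquely_colourable \<rho> l)"
proof (rule almost_all_if_extension_structure[OF order_refl])
  fix M :: "nat rel_struct" assume "extension_structure gadget_size M"
  then obtain n \<gamma>\<^sub>0 where U: "universe M = {1..n}"
    and M: "in_class n M" "colouring \<rho> l M \<gamma>\<^sub>0" "extension gadget_size M \<gamma>\<^sub>0"
    by (rule extension_structureE)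
  show "uniquely_colourable \<rho> l M"
    unfolding uniquely_colourable_def colourable_def U
    using M(2) extension_unique_colouring[OF M(1,3) order_refl M(2)] by blast
qed

end

theorem theorem10p3:
  fixes l \<rho> :: nat and r :: "nat \<Rightarrow> nat" and I :: "nat set"
  assumes "l \<ge> 2"
    and "\<rho> > 0"
    and "\<And>k. k \<in> {1..\<rho>} \<Longrightarrow> r k \<ge> 2"
    and "I \<subseteq> {1..\<rho>}"
  shows "(\<exists>\<xi>. binary_fm \<rho> r \<xi> \<and>
            almost_all (C \<rho> r l I)
              (\<lambda>M. \<forall>\<gamma>. colouring \<rho> l M \<gamma> \<longrightarrow>
                 (\<forall>a\<in>universe M. \<forall>b\<in>universe M. \<gamma> a = \<gamma> b \<longleftrightarrow> models2 M \<xi> a b))) \<and>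
         almost_all (C \<rho> r l I) (uniquely_colourable \<rho> l) \<and>
         zero_one_law \<rho> r (C \<rho> r l I)"
proof -
  interpret coloured_vocabulary l \<rho> r I
    using assms by unfold_locales auto
  show ?thesis
    using almost_all_colouring_definable almost_all_uniquely_colourable zero_one_law_C by blast
qed

end
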